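(* Let $p\geq 3$ be an integer. The pineapple graph $K_p^2$ is determined by the spectrum of its adjacency matrix; that is, every graph $G$ whose adjacency matrix has the same spectrum (eigenvalues with multiplicities) as that of $K_p^2$ is isomorphic to $K_p^2$.
   Context: Graphs are finite, simple and undirected, and not assumed connected. For integers $p\geq 3$ and $q\geq 1$, the pineapple graph $K_p^q$ is the graph on $p+q$ vertices obtained from the complete graph $K_p$ by appending $q$ pendant edges to one vertex of $K_p$ (i.e. adding $q$ new vertices, each adjacent only to one fixed vertex of $K_p$, the same one for all new vertices). *)

theory Defs
  imports
    "Graph_Theory.Digraph_Isomorphism"
    "Jordan_Normal_Form.Char_Poly"
begin

text \<open>
  A finite simple undirected graph is a \<^locale>\<open>pair_graph\<close>: a finite vertex set with a finite
  symmetric irreflexive set of arcs, so that the edge \<open>uv\<close> is the pair of arcs \<open>(u, v)\<close>, \<open>(v, u)\<close>.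
\<close>

definition adjacency_matrix :: "'v pair_pre_digraph \<Rightarrow> 'v list \<Rightarrow> 'a :: zero_neq_one mat" where
  "adjacency_matrix G vs =
     mat (length vs) (length vs) (\<lambda>(i, j). if (vs ! i, vs ! j) \<in> parcs G then 1 else 0)"

definition vertex_enumeration :: "'v pair_pre_digraph \<Rightarrow> 'v list \<Rightarrow> bool" where
  "vertex_enumeration G vs \<longleftrightarrow> distinct vs \<and> set vs = pverts G"

text \<open>
  Eigenvalues with algebraic multiplicity. They are taken over the complex numbers, so that none
  can be missing (they are in fact real). The chosen enumeration of the vertices
  is irrelevant, see \<open>adjacency_spectrum_eq\<close> below.
\<close>

definition adjacency_spectrum :: "'v pair_pre_digraph \<Rightarrow> complex multiset" where
  "adjacency_spectrum G =
     proots (char_poly (adjacency_matrix G (SOME vs. vertex_enumeration G vs)))"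

text \<open>
  The clique is \<open>{0..<p}\<close>, the pendant vertices are \<open>{p..<p + q}\<close>, all attached to vertex \<open>0\<close>.
\<close>

definition pineapple :: "nat \<Rightarrow> nat \<Rightarrow> nat pair_pre_digraph" where
  "pineapple p q =
     \<lparr> pverts = {0..<p + q},
       parcs = {(i, j). i < p \<and> j < p \<and> i \<noteq> j}
             \<union> {0} \<times> {p..<p + q}
             \<union> {p..<p + q} \<times> {0} \<rparr>"

lemma pair_graph_pineapple:
  assumes "p \<ge> 1"
  shows "pair_graph (pineapple p q)"
proof -
  have "finite {(i, j). i < p \<and> j < p \<and> i \<noteq> j}"
    by (rule finite_subset[of _ "{..<p} \<times> {..<p}"]) auto
  then show ?thesis
    using assms
    by unfold_locales (auto simp: pineapple_def symmetric_def sym_def)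
qed

lemma char_poly_adjacency_matrix_unique:
  assumes "vertex_enumeration G us" "vertex_enumeration G vs"
  shows "char_poly (adjacency_matrix G us :: 'a :: field mat) =
         char_poly (adjacency_matrix G vs)"
proof -
  define n where "n = length us"
  have n: "length vs = n"
    using assms unfolding n_def vertex_enumeration_def by (metis distinct_card)
  let ?P = "mat n n (\<lambda>(i, j). if us ! i = vs ! j then 1 else 0) :: 'a mat"
  let ?Q = "mat n n (\<lambda>(i, j). if vs ! i = us ! j then 1 else 0) :: 'a mat"
  let ?A = "adjacency_matrix G us :: 'a mat" and ?B = "adjacency_matrix G vs :: 'a mat"
  have "mset us = mset vs"
    using assms unfolding vertex_enumeration_def by (metis set_eq_iff_mset_eq_distinct)
  then obtain f where f: "f permutes {..<n}" "permute_list f vs = us"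
    using mset_eq_permutation[of us vs] n by metis
  have us: "us ! i = vs ! f i" if "i < n" for i
    using f n that permute_list_nth[of f vs i] by auto
  have fn: "f i < n" if "i < n" for i
    using f(1) that by (metis lessThan_iff permutes_in_image)
  have dvs: "vs ! i = vs ! j \<longleftrightarrow> i = j" if "i < n" "j < n" for i j
    using assms(2) that n by (simp add: vertex_enumeration_def nth_eq_iff_index_eq)
  have finj: "f i = f j \<longleftrightarrow> i = j" for i j
    using permutes_inj[OF f(1)] by (simp add: inj_eq)
  have P: "?P = mat n n (\<lambda>(i, j). if f i = j then 1 else 0)"
    by (rule eq_matI) (auto simp: us dvs fn)
  have Q: "?Q = mat n n (\<lambda>(i, j). if i = f j then 1 else 0)"
    by (rule eq_matI) (auto simp: us dvs fn)
  have A: "?A = mat n n (\<lambda>(i, j). ?B $$ (f i, f j))"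
    by (rule eq_matI) (auto simp: adjacency_matrix_def us fn n n_def[symmetric])
  have dB: "dim_row ?B = n" "dim_col ?B = n"
    by (auto simp: adjacency_matrix_def n)
  have PQ: "?P * ?Q = 1\<^sub>m n"
    unfolding P Q
    by (rule eq_matI)
      (auto simp: scalar_prod_def finj fn if_distrib[of "\<lambda>x. x * _"] sum.delta cong: if_cong)
  have QP: "?Q * ?P = 1\<^sub>m n"
    by (rule mat_mult_left_right_inverse[OF _ _ PQ]) auto
  have PB: "?P * ?B = mat n n (\<lambda>(i, j). ?B $$ (f i, j))"
    unfolding P
    by (rule eq_matI)
      (auto simp: scalar_prod_def dB fn if_distrib[of "\<lambda>x. x * _"] sum.delta cong: if_cong)
  have "?P * ?B * ?Q = ?A"
    unfolding PB A unfolding Q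
    by (rule eq_matI)
      (auto simp: scalar_prod_def dB fn if_distrib[of "\<lambda>x. _ * x"] sum.delta cong: if_cong)
  then have "similar_mat ?A ?B"
    unfolding similar_mat_def similar_mat_wit_def
    using PQ QP dB A by (intro exI[of _ ?P] exI[of _ ?Q]) (auto simp: Let_def A)
  then show ?thesis
    by (rule char_poly_similar)
qed

lemma adjacency_spectrum_eq:
  assumes "vertex_enumeration G vs"
  shows "adjacency_spectrum G = proots (char_poly (adjacency_matrix G vs))"
  unfolding adjacency_spectrum_def
  using char_poly_adjacency_matrix_unique[OF someI[of "vertex_enumeration G", OF assms] assms]
  by metis

end

theory Submission
  imports
    Defs
    "Jordan_Normal_Form.Schur_Decomposition"
begin

text \<open>
  Real symmetric matrices with equal characteristic polynomials are orthogonally similar, so a graph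
  \<open>G\<close> cospectral with \<open>K\<^sub>p\<^sup>2\<close> comes with an orthonormal family of vectors, one for each vertex, on
  which the quadratic form of \<open>K\<^sub>p\<^sup>2\<close> takes the values of the adjacency matrix of \<open>G\<close>.
  Three properties of this form are used. The smallest eigenvalue of \<open>K\<^sub>p\<^sup>2\<close> exceeds \<open>-2\<close>, so
  \<open>G\<close> has no induced \<open>C\<^sub>4\<close>; the second largest is below 1, so \<open>G\<close> has no induced \<open>2K\<^sub>2\<close>; and
  \<open>A + I\<close> has rank 4 and signature (3, 1), so \<open>G\<close> has no induced \<open>C\<^sub>5\<close> or bull and no independent
  set of size 4. Hence \<open>G\<close> is a split graph consisting of a maximum clique and an independent
  set \<open>S\<close> with at most 3 vertices. If \<open>S\<close> had three vertices, then the rank would force one of them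
  to be adjacent to the whole clique. The number of edges excludes fewer than two vertices and leaves
  two edges between \<open>S\<close> and the clique, and the number of triangles and the absence of a bull
  determine where these edges are.
\<close>

section \<open>Cospectral symmetric matrices\<close>

lemma transpose_orthogonal:
  fixes U :: "real mat"
  assumes U: "U \<in> carrier_mat n n" and orth: "transpose_mat U * U = 1\<^sub>m n"
  shows "U * transpose_mat U = 1\<^sub>m n"
  using mat_mult_left_right_inverse[OF _ U orth] U by simp

text \<open>Gram-Schmidt keeps the first vector of a basis, so a basis starting with
  \<open>v\<close> yields, after normalisation, an orthogonal matrix whose first column is a
  multiple of \<open>v\<close>.\<close>

lemma orthogonal_completion:
  fixes v :: "real vec"
  assumes v: "v \<in> carrier_vec n" and v0: "v \<noteq> 0\<^sub>v n"
  obtains U c where "U \<in> carrier_mat n n" "transpose_mat U * U = 1\<^sub>m n" "col U 0 = c \<cdot>\<^sub>v v"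
proof -
  interpret cof_vec_space n "TYPE(real)" .
  define b where "b = basis_completion v"
  define ws where "ws = gram_schmidt n b"
  note basis = basis_completion[OF v v0, folded b_def]
  have n: "n > 0"
    using v v0 by (cases n) auto
  with basis obtain vs where bv: "b = v # vs"
    by (cases b) auto
  have ws: "set ws \<subseteq> carrier_vec n" "corthogonal ws" "length ws = n"
    using gram_schmidt_result[OF basis(2,4,5) refl, folded ws_def] basis(6) by auto
  have hd_ws: "ws ! 0 = v"
    using gram_schmidt_hd[OF v, of vs, folded bv ws_def] ws(3) n by (metis hd_conv_nth list.size(3) neq0_conv)
  define f :: "real vec \<Rightarrow> real vec" where "f w = (1 / sqrt (w \<bullet> w)) \<cdot>\<^sub>v w" for w
  define U where "U = mat_of_cols n (map f ws)"
  have U: "U \<in> carrier_mat n n"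
    using ws(3) unfolding U_def by (metis length_map mat_of_cols_carrier(1))
  have wsi: "ws ! i \<in> carrier_vec n" if "i < n" for i
    using ws that by auto
  have col: "col U i = f (ws ! i)" if "i < n" for i
    unfolding U_def using that ws wsi[OF that] by (subst col_mat_of_cols) (auto simp: f_def)
  \<comment> \<open>Over the reals \<open>corthogonal\<close> refers to the plain scalar product.
    The case \<open>i = j\<close> says that no norm vanishes, which the division in \<open>f\<close>
    relies on.\<close>
  have orth: "ws ! i \<bullet> ws ! j = 0 \<longleftrightarrow> i \<noteq> j" if "i < n" "j < n" for i j
    using corthogonalD[OF ws(2), of i j] that ws(3) by simp
  have "transpose_mat U * U = 1\<^sub>m n"
  proof (rule eq_matI)
    fix i j assume "i < dim_row (1\<^sub>m n :: real mat)" "j < dim_col (1\<^sub>m n :: real mat)"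
    then have ij: "i < n" "j < n" by auto
    have "(transpose_mat U * U) $$ (i, j) = f (ws ! i) \<bullet> f (ws ! j)"
      using ij U by (simp add: col)
    also have "\<dots> = (ws ! i \<bullet> ws ! j) / (sqrt (ws ! i \<bullet> ws ! i) * sqrt (ws ! j \<bullet> ws ! j))"
      using wsi[OF ij(1)] wsi[OF ij(2)] by (simp add: f_def)
    also have "\<dots> = 1\<^sub>m n $$ (i, j)"
    proof -
      have "ws ! i \<bullet> ws ! i \<ge> 0"
        by (auto simp: scalar_prod_def intro: sum_nonneg)
      then show ?thesis
        using orth[OF ij] ij orth[OF ij(1) ij(1)] by auto
    qed
    finally show "(transpose_mat U * U) $$ (i, j) = 1\<^sub>m n $$ (i, j)" .
  qed (use U in auto)
  with that[OF U, of "1 / sqrt (v \<bullet> v)"] show thesis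
    using col[OF n] hd_ws by (simp add: f_def)
qed

text \<open>Deflation by induction on the list of roots: an eigenvector for \<open>e\<close> becomes
  the first column of an orthogonal matrix, conjugation splits off the 1 by 1 block
  \<open>e\<close>, and the induction hypothesis applies to the remaining symmetric block.\<close>

lemma real_spectral_theorem:
  fixes A :: "real mat"
  assumes "A \<in> carrier_mat n n" "transpose_mat A = A"
    and "char_poly A = (\<Prod>e\<leftarrow>es. [:- e, 1:])"
  shows "\<exists>U \<in> carrier_mat n n. transpose_mat U * U = 1\<^sub>m n \<and>
           A = U * mat_diag n ((!) es) * transpose_mat U"
  using assms
proof (induction es arbitrary: n A)
  case Nil
  then have "n = 0"
    using degree_monic_char_poly[OF Nil(1)] by simp
  with Nil show ?case
    by (intro bexI[of _ "1\<^sub>m 0"]) auto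
next
  case (Cons e es)
  note A = Cons.prems(1) and sym = Cons.prems(2)
  have "poly (char_poly A) e = 0"
    unfolding Cons.prems(3) by simp
  then obtain v where "eigenvector A v e"
    using eigenvalue_root_char_poly[OF A] eigenvalue_def by blast
  then have v: "v \<in> carrier_vec n" "v \<noteq> 0\<^sub>v n" "A *\<^sub>v v = e \<cdot>\<^sub>v v"
    using A by (auto simp: eigenvector_def)
  then obtain m where n: "n = Suc m"
    by (cases n) auto
  obtain U c where U: "U \<in> carrier_mat n n" and UU: "transpose_mat U * U = 1\<^sub>m n"
    and col0: "col U 0 = c \<cdot>\<^sub>v v"
    using orthogonal_completion[OF v(1,2)] .
  define T where "T = transpose_mat U"
  have T: "T \<in> carrier_mat n n" and tT: "transpose_mat T = U"
    using U by (auto simp: T_def)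
  have TU: "T * U = 1\<^sub>m n" and UT: "U * T = 1\<^sub>m n"
    using UU transpose_orthogonal[OF U UU] by (auto simp: T_def)
  define B where "B = T * A * U"
  have B: "B \<in> carrier_mat n n"
    using A U T by (auto simp: B_def)
  have symB: "transpose_mat B = B"
  proof -
    have "transpose_mat B = transpose_mat U * transpose_mat (T * A)"
      unfolding B_def using A U T by (intro transpose_mult) auto
    also have "transpose_mat (T * A) = A * U"
      using transpose_mult[OF T A] sym tT by simp
    finally show ?thesis
      unfolding B_def using A U T by (simp add: T_def assoc_mult_mat[of _ n n _ n _ n])
  qed
  have A_eq: "A = U * B * T"
  proof -
    have "U * B * T = (U * T) * A * (U * T)"
      unfolding B_def using A U T by (simp add: assoc_mult_mat[of _ n n _ n _ n])
    then show ?thesis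
      using A UT by simp
  qed
  \<comment> \<open>Column 0 of \<open>U\<close> is a multiple of the eigenvector, so column 0 of
    \<open>B\<close> is \<open>e\<close> times the first unit vector. Symmetry of \<open>B\<close>
    then clears row 0.\<close>
  have B0: "B $$ (i, 0) = (if i = 0 then e else 0)" if "i < n" for i
  proof -
    have "col B 0 = T *\<^sub>v (A *\<^sub>v col U 0)"
    proof -
      have "B = T * (A * U)"
        unfolding B_def using A U T by (intro assoc_mult_mat) auto
      also have "col \<dots> 0 = T *\<^sub>v col (A * U) 0"
        by (rule col_mult2) (use A U T n in auto)
      also have "col (A * U) 0 = A *\<^sub>v col U 0"
        by (rule col_mult2) (use A U n in auto)
      finally show ?thesis .
    qed
    also have "A *\<^sub>v col U 0 = e \<cdot>\<^sub>v col U 0"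
      unfolding col0 using A v by (simp add: mult_mat_vec smult_smult_assoc mult.commute)
    also have "T *\<^sub>v (e \<cdot>\<^sub>v col U 0) = e \<cdot>\<^sub>v col (T * U) 0"
    proof -
      have "col (T * U) 0 = T *\<^sub>v col U 0"
        by (rule col_mult2) (use U T n in auto)
      then show ?thesis
        using mult_mat_vec[of T n n "col U 0" e] T U n by auto
    qed
    finally have "col B 0 = e \<cdot>\<^sub>v col (1\<^sub>m n) 0"
      unfolding TU .
    from arg_cong[OF this, of "\<lambda>x. x $ i"] show ?thesis
      using that B n by auto
  qed
  define C where "C = mat m m (\<lambda>(i, j). B $$ (Suc i, Suc j))"
  have C: "C \<in> carrier_mat m m" by (simp add: C_def)
  have B_sym: "B $$ (i, j) = B $$ (j, i)" if "i < n" "j < n" for i j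
    using arg_cong[OF symB, of "\<lambda>M. M $$ (i, j)"] that B by auto
  have symC: "transpose_mat C = C"
    by (rule eq_matI) (auto simp: C_def n intro: B_sym)
  let ?E = "mat 1 1 (\<lambda>_. e)"
  have B_block: "B = four_block_mat ?E (0\<^sub>m 1 m) (0\<^sub>m m 1) C"
  proof (rule eq_matI)
    fix i j assume "i < dim_row (four_block_mat ?E (0\<^sub>m 1 m) (0\<^sub>m m 1) C)"
      "j < dim_col (four_block_mat ?E (0\<^sub>m 1 m) (0\<^sub>m m 1) C)"
    then have ij: "i < n" "j < n" by (auto simp: n C_def)
    show "B $$ (i, j) = four_block_mat ?E (0\<^sub>m 1 m) (0\<^sub>m m 1) C $$ (i, j)"
      using ij B0[OF ij(1)] B0[OF ij(2)] B_sym[OF ij]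
      by (cases i; cases j) (auto simp: n C_def)
  qed (use B n in \<open>auto simp: C_def\<close>)
  have "similar_mat A B"
    unfolding similar_mat_def similar_mat_wit_def
    using A B U T UT TU A_eq by (intro exI[of _ U] exI[of _ T]) (auto simp: Let_def)
  then have "[:- e, 1:] * (\<Prod>e\<leftarrow>es. [:- e, 1:]) = char_poly B"
    using char_poly_similar Cons.prems(3) by fastforce
  also have "\<dots> = char_poly ?E * char_poly C"
    unfolding B_block by (rule char_poly_four_block_zeros_col) (use C in auto)
  also have "char_poly ?E = [:- e, 1:]"
    by (simp add: char_poly_defs det_def sign_def)
  finally have "char_poly C = (\<Prod>e\<leftarrow>es. [:- e, 1:])"
    by (metis mult_cancel_left pCons_eq_0_iff zero_neq_one)
  from Cons.IH[OF C symC this] obtain W where W: "W \<in> carrier_mat m m"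
    and WW: "transpose_mat W * W = 1\<^sub>m m"
    and C_eq: "C = W * mat_diag m ((!) es) * transpose_mat W"
    by blast
  let ?D = "mat_diag m ((!) es)"
  \<comment> \<open>The orthogonal matrix of the smaller block, extended by a 1, diagonalises
    \<open>B\<close>; hence \<open>U * V\<close> diagonalises \<open>A\<close>.\<close>
  define V where "V = four_block_mat (1\<^sub>m 1) (0\<^sub>m 1 m) (0\<^sub>m m 1) W"
  have V: "V \<in> carrier_mat n n"
    using W by (auto simp: V_def n)
  have tV: "transpose_mat V = four_block_mat (1\<^sub>m 1) (0\<^sub>m 1 m) (0\<^sub>m m 1) (transpose_mat W)"
    unfolding V_def using W by (subst transpose_four_block_mat[of _ 1 1 _ m _ m]) auto
  have VV: "transpose_mat V * V = 1\<^sub>m n"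
    unfolding tV unfolding V_def using W
    by (subst mult_four_block_mat[of _ 1 1 _ m _ m _ _ 1 _ m]) (auto simp: WW n)
  have D_block: "mat_diag n ((!) (e # es)) = four_block_mat ?E (0\<^sub>m 1 m) (0\<^sub>m m 1) ?D"
    by (rule eq_matI) (auto simp: n mat_diag_def nth_Cons')
  have "V * mat_diag n ((!) (e # es)) = four_block_mat ?E (0\<^sub>m 1 m) (0\<^sub>m m 1) (W * ?D)"
    unfolding D_block V_def using W
    by (subst mult_four_block_mat[of _ 1 1 _ m _ m _ _ 1 _ m])
      (auto simp: left_mult_zero_mat[OF mat_diag_dim])
  moreover have "\<dots> * transpose_mat V = B"
  proof -
    have WD: "W * ?D \<in> carrier_mat m m" "W * ?D * transpose_mat W \<in> carrier_mat m m"
      using W mat_diag_dim[of m "(!) es"] by auto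
    then show ?thesis
      unfolding tV B_block C_eq using W
      by (subst mult_four_block_mat[of _ 1 1 _ m _ m _ _ 1 _ m])
        (auto simp: right_mult_zero_mat[OF WD(1)] left_add_zero_mat[OF WD(2)])
  qed
  ultimately have "V * mat_diag n ((!) (e # es)) * transpose_mat V = B"
    by simp
  then have "A = U * (V * mat_diag n ((!) (e # es)) * transpose_mat V) * T"
    unfolding A_eq by simp
  also have "\<dots> = (U * V) * mat_diag n ((!) (e # es)) * (transpose_mat V * T)"
  proof -
    have *: "U * (V * D * V') * T = (U * V) * D * (V' * T)"
      if "D \<in> carrier_mat n n" "V' \<in> carrier_mat n n" for D V'
    proof -
      have "V * D \<in> carrier_mat n n" "V' * T \<in> carrier_mat n n" "D * V' \<in> carrier_mat n n"
        using that V T by auto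
      with that show ?thesis
        using U V T by (simp add: assoc_mult_mat[of _ n n _ n _ n])
    qed
    show ?thesis
      by (rule *) (use V in auto)
  qed
  finally have "A = (U * V) * mat_diag n ((!) (e # es)) * (transpose_mat V * T)" .
  moreover have "transpose_mat (U * V) = transpose_mat V * T"
    using U V by (simp add: T_def transpose_mult)
  moreover have "transpose_mat V * T * (U * V) = 1\<^sub>m n"
  proof -
    have "transpose_mat V * T * (U * V) = transpose_mat V * (T * U) * V"
      using U V T by (simp add: assoc_mult_mat[of _ n n _ n _ n])
    then show ?thesis using TU VV V by simp
  qed
  ultimately show ?case
    using U V by (intro bexI[of _ "U * V"]) auto
qed

text \<open>Over the complex numbers the polynomial splits. Each root \<open>e\<close> is real: at
  an eigenvector \<open>v\<close>, the Hermitian form of \<open>A\<close> equals its own conjugate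
  and is \<open>e\<close> times the squared norm of \<open>v\<close>.\<close>

lemma real_symmetric_char_poly_splits:
  fixes A :: "real mat"
  assumes A: "A \<in> carrier_mat n n" and sym: "transpose_mat A = A"
  obtains es where "char_poly A = (\<Prod>e\<leftarrow>es. [:- e, 1:])"
proof -
  let ?C = "map_mat complex_of_real A"
  have C: "?C \<in> carrier_mat n n"
    using A by simp
  have A_sym: "A $$ (i, j) = A $$ (j, i)" if "i < n" "j < n" for i j
    using arg_cong[OF sym, of "\<lambda>M. M $$ (i, j)"] that A by auto
  obtain as where as: "char_poly ?C = (\<Prod>a\<leftarrow>as. [:- a, 1:])"
    using char_poly_factorized[OF C] by blast
  have real: "complex_of_real (Re e) = e" if "e \<in> set as" for e
  proof -
    have "poly (char_poly ?C) e = 0"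
      unfolding as poly_prod_list using that by (auto simp: prod_list_zero_iff)
    then obtain v where "eigenvector ?C v e"
      using eigenvalue_root_char_poly[OF C] eigenvalue_def by blast
    then have v: "v \<in> carrier_vec n" "v \<noteq> 0\<^sub>v n" "?C *\<^sub>v v = e \<cdot>\<^sub>v v"
      using A by (auto simp: eigenvector_def)
    have ev: "(\<Sum>j<n. of_real (A $$ (i, j)) * v $ j) = e * v $ i" if "i < n" for i
      using arg_cong[OF v(3), of "\<lambda>x. x $ i"] that A v(1)
      by (simp add: scalar_prod_def atLeast0LessThan)
    define S where "S = (\<Sum>i<n. \<Sum>j<n. cnj (v $ i) * of_real (A $$ (i, j)) * v $ j)"
    define N where "N = (\<Sum>i<n. cnj (v $ i) * v $ i)"
    have S: "S = e * N"
      unfolding S_def N_def sum_distrib_left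
      by (intro sum.cong refl)
        (simp add: mult.assoc sum_distrib_left[symmetric] ev mult.left_commute)
    have "cnj S = (\<Sum>i<n. \<Sum>j<n. cnj (v $ j) * of_real (A $$ (j, i)) * v $ i)"
      unfolding S_def by (auto intro!: sum.cong simp: A_sym mult_ac)
    also have "\<dots> = S"
      unfolding S_def by (rule sum.swap)
    finally have "cnj S = S" .
    moreover have N: "N = of_real (\<Sum>i<n. (cmod (v $ i))\<^sup>2)"
      unfolding N_def of_real_sum
      by (intro sum.cong refl) (simp add: mult.commute[of "cnj _"] complex_norm_square flip: of_real_power)
    moreover have "N \<noteq> 0"
    proof
      assume "N = 0"
      with N have "(\<Sum>i<n. (cmod (v $ i))\<^sup>2) = 0"
        by (metis of_real_eq_0_iff)
      then have "v $ i = 0" if "i < n" for i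
        using that by (subst (asm) sum_nonneg_eq_0_iff) auto
      then have "v = 0\<^sub>v n"
        using v(1) by (intro eq_vecI) auto
      with v(2) show False by simp
    qed
    ultimately have "cnj e = e"
      unfolding S by simp
    then show ?thesis
      by (metis Reals_cnj_iff of_real_Re)
  qed
  interpret of_real_poly: map_poly_inj_comm_ring_hom "of_real :: real \<Rightarrow> complex" ..
  \<comment> \<open>The embedding of real into complex polynomials is injective, so the
    factorisation with the real parts of the roots descends to the reals.\<close>
  have "map_poly complex_of_real (char_poly A) = char_poly ?C"
    by (rule of_real_hom.char_poly_hom[OF A, symmetric])
  also have "\<dots> = (\<Prod>a\<leftarrow>as. map_poly complex_of_real [:- Re a, 1:])"
    unfolding as using real by (intro arg_cong[of _ _ prod_list] map_cong) auto
  also have "\<dots> = map_poly complex_of_real (\<Prod>e\<leftarrow>map Re as. [:- e, 1:])"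
    by (simp add: of_real_poly.hom_prod_list o_def)
  finally have "char_poly A = (\<Prod>e\<leftarrow>map Re as. [:- e, 1:])"
    by simp
  then show thesis by (rule that)
qed

text \<open>Both matrices are orthogonally diagonalised with the same list \<open>es\<close> in the
  same order; \<open>Q\<close> is composed of the two diagonalising matrices.\<close>

lemma cospectral_symmetric_imp_orthogonally_similar:
  fixes A B :: "real mat"
  assumes A: "A \<in> carrier_mat n n" "transpose_mat A = A"
    and B: "B \<in> carrier_mat n n" "transpose_mat B = B"
    and eq: "char_poly A = char_poly B"
  obtains Q where "Q \<in> carrier_mat n n" "transpose_mat Q * Q = 1\<^sub>m n"
    "A = Q * B * transpose_mat Q"
proof -
  obtain es where es: "char_poly A = (\<Prod>e\<leftarrow>es. [:- e, 1:])"
    using real_symmetric_char_poly_splits[OF A] .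
  define D where "D = mat_diag n ((!) es)"
  have D: "D \<in> carrier_mat n n"
    by (simp add: D_def)
  obtain U where U: "U \<in> carrier_mat n n" "transpose_mat U * U = 1\<^sub>m n"
    and A_eq: "A = U * D * transpose_mat U"
    using real_spectral_theorem[OF A es] unfolding D_def by blast
  obtain W where W: "W \<in> carrier_mat n n" "transpose_mat W * W = 1\<^sub>m n"
    and B_eq: "B = W * D * transpose_mat W"
    using real_spectral_theorem[OF B es[unfolded eq]] unfolding D_def by blast
  note UU = transpose_orthogonal[OF U] and WW = transpose_orthogonal[OF W]
  define U' where "U' = transpose_mat U"
  define W' where "W' = transpose_mat W"
  have U': "U' \<in> carrier_mat n n" and W': "W' \<in> carrier_mat n n"
    using U W by (auto simp: U'_def W'_def)
  have tQ: "transpose_mat (U * W') = W * U'"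
    using transpose_mult[OF U(1) W'] by (simp add: U'_def W'_def)
  note [simp] = assoc_mult_mat[of _ n n _ n _ n]
  have cancel: "W' * (W * X) = X" "U' * (U * X) = X" if "X \<in> carrier_mat n n" for X
    using that U U' W W' by (simp_all flip: assoc_mult_mat add: U'_def W'_def)
  show thesis
  proof (rule that[of "U * W'"])
    show "U * W' \<in> carrier_mat n n"
      using U W' by simp
    show "transpose_mat (U * W') * (U * W') = 1\<^sub>m n"
      unfolding tQ using U U' W W' WW cancel by (simp add: W'_def)
    have "U * W' * B * (W * U') = U * (W' * (W * (D * (W' * (W * U')))))"
      unfolding B_eq W'_def[symmetric] using U(1) U' W(1) W' D by simp
    also have "\<dots> = U * (D * U')"
      using U' D W W' by (simp add: cancel)
    also have "\<dots> = A"
      unfolding A_eq U'_def[symmetric] using U(1) U' D by simp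
    finally show "A = U * W' * B * transpose_mat (U * W')"
      unfolding tQ by simp
  qed
qed

section \<open>Traces of squares and cubes, and characteristic polynomials from their roots\<close>

definition trace :: "'a :: comm_monoid_add mat \<Rightarrow> 'a" where
  "trace A = (\<Sum>i<dim_row A. A $$ (i, i))"

lemma trace_mult:
  fixes A B :: "'a :: comm_semiring_0 mat"
  assumes "A \<in> carrier_mat n m" "B \<in> carrier_mat m n"
  shows "trace (A * B) = (\<Sum>i<n. \<Sum>j<m. A $$ (i, j) * B $$ (j, i))"
  using assms by (auto simp: trace_def scalar_prod_def atLeast0LessThan intro!: sum.cong)

lemma trace_mult_commute:
  fixes A B :: "'a :: comm_semiring_0 mat"
  assumes "A \<in> carrier_mat n m" "B \<in> carrier_mat m n"
  shows "trace (A * B) = trace (B * A)"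
  unfolding trace_mult[OF assms] trace_mult[OF assms(2,1)]
  by (subst sum.swap) (simp add: mult.commute)

text \<open>Squares and cubes are conjugated by the same \<open>Q\<close>, and cyclicity of the
  trace removes it. For adjacency matrices these traces count arcs and triangles.\<close>

lemma trace_orthogonal_conjugate:
  fixes Q B :: "real mat"
  assumes Q: "Q \<in> carrier_mat n n" "transpose_mat Q * Q = 1\<^sub>m n"
    and B: "B \<in> carrier_mat n n"
  defines "A \<equiv> Q * B * transpose_mat Q"
  shows "trace (A * A) = trace (B * B)" "trace (A * A * A) = trace (B * B * B)"
proof -
  define T where "T = transpose_mat Q"
  have T: "T \<in> carrier_mat n n" and TQ: "T * Q = 1\<^sub>m n"
    using Q by (auto simp: T_def)
  note [simp] = assoc_mult_mat[of _ n n _ n _ n]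
  have cancel: "T * (Q * X) = X" if "X \<in> carrier_mat n n" for X
    using that Q(1) T TQ by (simp flip: assoc_mult_mat)
  have tr: "trace (Q * X * T) = trace X" if X: "X \<in> carrier_mat n n" for X
  proof -
    have "trace (Q * X * T) = trace (T * (Q * X))"
      by (rule trace_mult_commute[of _ n n]) (use Q T X in auto)
    with cancel[OF X] show ?thesis by simp
  qed
  have "A * A = Q * (B * B) * T" "A * A * A = Q * (B * B * B) * T"
    unfolding A_def T_def[symmetric] using Q(1) T B cancel by simp_all
  with tr[of "B * B"] tr[of "B * B * B"] B
  show "trace (A * A) = trace (B * B)" "trace (A * A * A) = trace (B * B * B)"
    by auto
qed

lemma proots_prod_linear_factors:
  "proots (\<Prod>a\<leftarrow>as. [:- a, 1:]) = mset (as :: 'a :: idom list)"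
proof (induction as)
  case (Cons a as)
  let ?P = "\<Prod>a\<leftarrow>as. [:- a, 1:]"
  have "?P \<noteq> 0"
    by (auto simp: prod_list_zero_iff)
  then have "proots ([:- a, 1:] * ?P) = proots [:- a, 1:] + proots ?P"
    by (intro proots_mult) auto
  with Cons show ?case
    by (simp del: mult_pCons_left)
qed simp

text \<open>Both polynomials are products of monic linear factors, so the multiset of roots
  determines them. The sizes \<open>n\<close> and \<open>m\<close> are independent because
  cospectral graphs are only later shown to have equally many vertices.\<close>

lemma complex_char_poly_eqI_proots:
  fixes A B :: "complex mat"
  assumes "A \<in> carrier_mat n n" "B \<in> carrier_mat m m"
    and "proots (char_poly A) = proots (char_poly B)"
  shows "char_poly A = char_poly B"
proof -
  obtain as bs where as: "char_poly A = (\<Prod>a\<leftarrow>as. [:- a, 1:])"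
    and bs: "char_poly B = (\<Prod>b\<leftarrow>bs. [:- b, 1:])"
    using char_poly_factorized[OF assms(1)] char_poly_factorized[OF assms(2)] by blast
  have "mset as = mset bs"
    using assms(3) unfolding as bs proots_prod_linear_factors .
  then show ?thesis
    unfolding as bs by (metis mset_map prod_mset_prod_list)
qed

section \<open>Cospectral graphs\<close>

text \<open>The triples are ordered, so each triangle of a simple graph is counted six times,
  exactly as in the trace of the cube of the adjacency matrix.\<close>

definition triangles :: "'v pair_pre_digraph \<Rightarrow> ('v \<times> 'v \<times> 'v) set" where
  "triangles G = {(u, v, w). (u, v) \<in> parcs G \<and> (v, w) \<in> parcs G \<and> (w, u) \<in> parcs G}"

lemma adjacency_matrix_carrier [simp]:
  "adjacency_matrix G vs \<in> carrier_mat (length vs) (length vs)"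
  by (simp add: adjacency_matrix_def)

lemma (in pair_graph) arc_sym: "(u, v) \<in> parcs G \<longleftrightarrow> (v, u) \<in> parcs G"
  using pair_sym_arcs by (auto simp: symmetric_def sym_def)

lemma (in pair_graph) transpose_adjacency_matrix: "transpose_mat (adjacency_matrix G vs) = adjacency_matrix G vs"
  by (rule eq_matI) (auto simp: adjacency_matrix_def arc_sym)

lemma sum_nth_vertex_enumeration:
  assumes "vertex_enumeration G vs"
  shows "(\<Sum>i<length vs. f (vs ! i)) = (\<Sum>v\<in>pverts G. f v)"
  using assms by (intro sum.reindex_bij_betw bij_betw_nth) (auto simp: vertex_enumeration_def)

lemma (in pair_graph) trace_adjacency_matrix_power2:
  assumes vs: "vertex_enumeration G vs"
  defines "A \<equiv> adjacency_matrix G vs :: real mat"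
  shows "trace (A * A) = real (card (parcs G))"
proof -
  have "trace (A * A) = (\<Sum>i<length vs. \<Sum>j<length vs. of_bool ((vs ! i, vs ! j) \<in> parcs G))"
    by (auto simp: A_def trace_def adjacency_matrix_def scalar_prod_def atLeast0LessThan of_bool_def arc_sym
        intro!: sum.cong)
  also have "\<dots> = (\<Sum>u\<in>pverts G. \<Sum>v\<in>pverts G. of_bool ((u, v) \<in> parcs G))"
    unfolding sum_nth_vertex_enumeration[OF vs, of "\<lambda>v. of_bool ((_, v) \<in> parcs G)"]
    by (rule sum_nth_vertex_enumeration[OF vs])
  also have "\<dots> = (\<Sum>x\<in>pverts G \<times> pverts G. of_bool (x \<in> parcs G))"
    by (simp only: sum.cartesian_product split_def prod.collapse)
  also have "\<dots> = real (card {x \<in> pverts G \<times> pverts G. x \<in> parcs G})"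
    by (simp add: pair_finite_verts Int_def)
  also have "{x \<in> pverts G \<times> pverts G. x \<in> parcs G} = parcs G"
    by (auto dest: in_arcsD1 in_arcsD2)
  finally show ?thesis .
qed

lemma (in pair_graph) trace_adjacency_matrix_power3:
  assumes vs: "vertex_enumeration G vs"
  defines "A \<equiv> adjacency_matrix G vs :: real mat"
  shows "trace (A * A * A) = real (card (triangles G))"
proof -
  let ?a = "\<lambda>u v. of_bool ((u, v) \<in> parcs G) :: real"
  have AA: "(A * A) $$ (i, k) = (\<Sum>j<length vs. ?a (vs ! i) (vs ! j) * ?a (vs ! j) (vs ! k))"
    if "i < length vs" "k < length vs" for i k
    using that by (simp add: A_def adjacency_matrix_def scalar_prod_def atLeast0LessThan of_bool_def)
  have "trace (A * A * A) =
      (\<Sum>i<length vs. \<Sum>k<length vs. (A * A) $$ (i, k) * ?a (vs ! k) (vs ! i))"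
  proof -
    have "A * A \<in> carrier_mat (length vs) (length vs)"
      unfolding A_def by (rule mult_carrier_mat) (rule adjacency_matrix_carrier)+
    from trace_mult[OF this, of A] show ?thesis
      by (simp add: A_def adjacency_matrix_def of_bool_def)
  qed
  also have "\<dots> = (\<Sum>i<length vs. \<Sum>k<length vs.
      (\<Sum>j<length vs. ?a (vs ! i) (vs ! j) * ?a (vs ! j) (vs ! k)) * ?a (vs ! k) (vs ! i))"
    by (intro sum.cong refl) (simp add: AA)
  \<comment> \<open>Sums over positions become sums over vertices one at a time, innermost
    first.\<close>
  also have "\<dots> = (\<Sum>i<length vs. \<Sum>k<length vs.
      (\<Sum>v\<in>pverts G. ?a (vs ! i) v * ?a v (vs ! k)) * ?a (vs ! k) (vs ! i))"
    by (simp only: sum_nth_vertex_enumeration[OF vs, of "\<lambda>v. ?a _ v * ?a v _"])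
  also have "\<dots> = (\<Sum>i<length vs. \<Sum>w\<in>pverts G.
      (\<Sum>v\<in>pverts G. ?a (vs ! i) v * ?a v w) * ?a w (vs ! i))"
    by (simp only: sum_nth_vertex_enumeration[OF vs, of "\<lambda>w. (\<Sum>v\<in>pverts G. ?a _ v * ?a v w) * ?a w _"])
  also have "\<dots> = (\<Sum>u\<in>pverts G. \<Sum>w\<in>pverts G. (\<Sum>v\<in>pverts G. ?a u v * ?a v w) * ?a w u)"
    by (rule sum_nth_vertex_enumeration[OF vs])
  also have "\<dots> = (\<Sum>u\<in>pverts G. \<Sum>v\<in>pverts G. \<Sum>w\<in>pverts G. of_bool ((u, v, w) \<in> triangles G))"
    unfolding sum_distrib_right
    by (rule sum.cong[OF refl], subst sum.swap, intro sum.cong refl) (auto simp: triangles_def)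
  also have "\<dots> = (\<Sum>x\<in>pverts G \<times> pverts G \<times> pverts G. of_bool (x \<in> triangles G))"
    by (simp only: sum.cartesian_product split_def prod.collapse)
  also have "\<dots> = real (card {x \<in> pverts G \<times> pverts G \<times> pverts G. x \<in> triangles G})"
    by (simp add: pair_finite_verts Int_def)
  also have "{x \<in> pverts G \<times> pverts G \<times> pverts G. x \<in> triangles G} = triangles G"
    by (auto simp: triangles_def dest: in_arcsD1 in_arcsD2)
  finally show ?thesis .
qed

text \<open>The spectrum is complex, but the entries 0 and 1 make the complex adjacency matrix the
  image of the real one, and the embedding of polynomials is injective.\<close>

lemma real_char_poly_eqI_adjacency_spectrum:
  assumes eq: "adjacency_spectrum G = adjacency_spectrum H"
    and us: "vertex_enumeration G us" and vs: "vertex_enumeration H vs"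
  shows "char_poly (adjacency_matrix G us :: real mat) = char_poly (adjacency_matrix H vs)"
proof -
  interpret of_real_poly: map_poly_inj_comm_ring_hom "of_real :: real \<Rightarrow> complex" ..
  have hom: "map_poly complex_of_real (char_poly (adjacency_matrix K ws)) = char_poly (adjacency_matrix K ws)"
    for K :: "'c pair_pre_digraph" and ws
  proof -
    have "map_mat complex_of_real (adjacency_matrix K ws) = adjacency_matrix K ws"
      by (rule eq_matI) (auto simp: adjacency_matrix_def)
    then show ?thesis
      by (simp add: of_real_hom.char_poly_hom[OF adjacency_matrix_carrier, symmetric])
  qed
  have "map_poly complex_of_real (char_poly (adjacency_matrix G us)) = char_poly (adjacency_matrix G us)"
    by (rule hom)
  also have "\<dots> = char_poly (adjacency_matrix H vs)"
    by (rule complex_char_poly_eqI_proots[OF adjacency_matrix_carrier adjacency_matrix_carrier])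
      (use eq adjacency_spectrum_eq[OF us] adjacency_spectrum_eq[OF vs] in simp)
  also have "\<dots> = map_poly complex_of_real (char_poly (adjacency_matrix H vs))"
    by (rule hom[symmetric])
  finally show ?thesis
    by simp
qed

text \<open>If A = Q B Q^T with \<open>Q\<close> orthogonal, then \<open>y u\<close> is the row of
  \<open>Q\<close> at the vertex \<open>u\<close>: the first equation is Q Q^T = 1, the second is an
  entry of A, and the last two counts are traces.\<close>

theorem cospectral_pair_graphs:
  fixes G :: "'v pair_pre_digraph" and H :: "'w pair_pre_digraph"
  assumes G: "pair_graph G" and H: "pair_graph H"
    and eq: "adjacency_spectrum G = adjacency_spectrum H"
  obtains y :: "'v \<Rightarrow> 'w \<Rightarrow> real" where
    "\<And>u v. u \<in> pverts G \<Longrightarrow> v \<in> pverts G \<Longrightarrow>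
       (\<Sum>k\<in>pverts H. y u k * y v k) = of_bool (u = v)"
    "\<And>u v. u \<in> pverts G \<Longrightarrow> v \<in> pverts G \<Longrightarrow>
       (\<Sum>k\<in>pverts H. \<Sum>l\<in>pverts H. y u k * y v l * of_bool ((k, l) \<in> parcs H)) =
       of_bool ((u, v) \<in> parcs G)"
    "card (pverts G) = card (pverts H)"
    "card (parcs G) = card (parcs H)"
    "card (triangles G) = card (triangles H)"
proof -
  interpret G: pair_graph G by (rule G)
  interpret H: pair_graph H by (rule H)
  obtain us where us: "vertex_enumeration G us"
    using finite_distinct_list[OF G.pair_finite_verts] by (auto simp: vertex_enumeration_def)
  obtain vs where vs: "vertex_enumeration H vs"
    using finite_distinct_list[OF H.pair_finite_verts] by (auto simp: vertex_enumeration_def)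
  define A where "A = (adjacency_matrix G us :: real mat)"
  define B where "B = (adjacency_matrix H vs :: real mat)"
  have cp: "char_poly A = char_poly B"
    unfolding A_def B_def by (rule real_char_poly_eqI_adjacency_spectrum[OF eq us vs])
  define n where "n = length us"
  have A: "A \<in> carrier_mat n n" "transpose_mat A = A"
    by (auto simp: A_def n_def G.transpose_adjacency_matrix)
  \<comment> \<open>The degree of the characteristic polynomial is the number of vertices.\<close>
  have "length us = length vs"
    using cp degree_monic_char_poly[of A "length us"] degree_monic_char_poly[of B "length vs"]
    by (simp add: A_def B_def)
  then have n: "length us = n" "length vs = n"
    by (auto simp: n_def)
  have B: "B \<in> carrier_mat n n" "transpose_mat B = B"
    using adjacency_matrix_carrier[of H vs] n by (auto simp: B_def H.transpose_adjacency_matrix)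
  obtain Q where Q: "Q \<in> carrier_mat n n" "transpose_mat Q * Q = 1\<^sub>m n"
    and AQ: "A = Q * B * transpose_mat Q"
    using cospectral_symmetric_imp_orthogonally_similar[OF A B cp] .
  note QQ = transpose_orthogonal[OF Q]
  \<comment> \<open>The positions of vertices in the two enumerations, used to index
    \<open>Q\<close> by vertices.\<close>
  define iu where "iu = the_inv_into {..<n} ((!) us)"
  define iv where "iv = the_inv_into {..<n} ((!) vs)"
  have bij: "bij_betw ((!) us) {..<n} (pverts G)" "bij_betw ((!) vs) {..<n} (pverts H)"
    using us vs n by (auto intro!: bij_betw_nth simp: vertex_enumeration_def)
  have iu: "iu (us ! i) = i" and iv: "iv (vs ! i) = i" if "i < n" for i
    using that bij by (auto simp: iu_def iv_def the_inv_into_f_f bij_betw_def)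
  define y where "y u k = Q $$ (iu u, iv k)" for u k
  have idx: "\<exists>i<n. u = us ! i" if "u \<in> pverts G" for u
    using that us n by (metis in_set_conv_nth vertex_enumeration_def)
  note sum_H = sum_nth_vertex_enumeration[OF vs, symmetric, unfolded n]
  show thesis
  proof (rule that[of y])
    fix u v assume "u \<in> pverts G" "v \<in> pverts G"
    then obtain i j where ij: "i < n" "j < n" and u: "u = us ! i" and v: "v = us ! j"
      using idx by metis
    have uv: "u = v \<longleftrightarrow> i = j"
      using iu ij u v by metis
    have "(\<Sum>k\<in>pverts H. y u k * y v k) = (Q * transpose_mat Q) $$ (i, j)"
      unfolding sum_H using ij Q by (simp add: y_def u v iu iv scalar_prod_def atLeast0LessThan)
    also have "\<dots> = of_bool (u = v)"
      unfolding QQ uv using ij by simp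
    finally show "(\<Sum>k\<in>pverts H. y u k * y v k) = of_bool (u = v)" .
    have "(\<Sum>k\<in>pverts H. \<Sum>l\<in>pverts H. y u k * y v l * of_bool ((k, l) \<in> parcs H)) =
        (\<Sum>k<n. \<Sum>l<n. Q $$ (i, k) * Q $$ (j, l) * B $$ (k, l))"
      unfolding sum_H using ij Q n
      by (intro sum.cong refl) (simp add: y_def u v iu iv B_def adjacency_matrix_def)
    also have "\<dots> = (\<Sum>l<n. (\<Sum>k<n. Q $$ (i, k) * B $$ (k, l)) * Q $$ (j, l))"
      unfolding sum_distrib_right by (subst sum.swap) (simp add: mult_ac)
    also have "\<dots> = A $$ (i, j)"
      unfolding AQ using ij Q B by (simp add: scalar_prod_def atLeast0LessThan del: assoc_mult_mat)
    also have "\<dots> = of_bool ((u, v) \<in> parcs G)"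
      using ij n by (simp add: A_def adjacency_matrix_def u v)
    finally show "(\<Sum>k\<in>pverts H. \<Sum>l\<in>pverts H. y u k * y v l * of_bool ((k, l) \<in> parcs H)) =
        of_bool ((u, v) \<in> parcs G)" .
  next
    show "card (pverts G) = card (pverts H)"
      using us vs n by (metis distinct_card vertex_enumeration_def)
    have "real (card (parcs G)) = real (card (parcs H))"
      using trace_orthogonal_conjugate(1)[OF Q B(1)] AQ
        G.trace_adjacency_matrix_power2[OF us] H.trace_adjacency_matrix_power2[OF vs]
      by (simp add: A_def B_def)
    then show "card (parcs G) = card (parcs H)" by simp
    have "real (card (triangles G)) = real (card (triangles H))"
      using trace_orthogonal_conjugate(2)[OF Q B(1)] AQ
        G.trace_adjacency_matrix_power3[OF us] H.trace_adjacency_matrix_power3[OF vs]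
      by (simp add: A_def B_def)
    then show "card (triangles G) = card (triangles H)" by simp
  qed
qed

section \<open>The quadratic form of the pineapple graph\<close>

text \<open>A zero row makes the system of \<open>m\<close> equations in \<open>m + 1\<close>
  unknowns square; expansion along that row shows that the determinant vanishes.\<close>

lemma homogeneous_system_nontrivial_solution:
  fixes f :: "nat \<Rightarrow> nat \<Rightarrow> 'a :: idom"
  obtains c where "\<exists>i\<le>m. c i \<noteq> 0" "\<And>j. j < m \<Longrightarrow> (\<Sum>i\<le>m. f j i * c i) = 0"
proof -
  define A where "A = mat (Suc m) (Suc m) (\<lambda>(j, i). if j < m then f j i else 0)"
  have A: "A \<in> carrier_mat (Suc m) (Suc m)"
    by (simp add: A_def)
  have "det A = (\<Sum>i<Suc m. A $$ (m, i) * cofactor A m i)"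
    by (rule laplace_expansion_row[OF A]) simp
  also have "\<dots> = 0"
    by (rule sum.neutral) (auto simp: A_def)
  finally obtain v where v: "v \<in> carrier_vec (Suc m)" "v \<noteq> 0\<^sub>v (Suc m)" "A *\<^sub>v v = 0\<^sub>v (Suc m)"
    using det_0_iff_vec_prod_zero[OF A] by blast
  show thesis
  proof (rule that)
    show "\<exists>i\<le>m. v $ i \<noteq> 0"
    proof (rule ccontr)
      assume "\<not> (\<exists>i\<le>m. v $ i \<noteq> 0)"
      then have "v = 0\<^sub>v (Suc m)"
        using v(1) by (intro eq_vecI) auto
      with v(2) show False ..
    qed
    fix j assume "j < m"
    then show "(\<Sum>i\<le>m. f j i * v $ i) = 0"
      using arg_cong[OF v(3), of "\<lambda>x. x $ j"] v(1)
      by (simp add: A_def scalar_prod_def atLeast0LessThan flip: lessThan_Suc_atMost)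
  qed
qed

text \<open>The bilinear form of the adjacency matrix of \<open>pineapple p 2\<close> in closed
  form: the all-ones matrix minus the identity on the clique, then the edges from 0 to the pendant
  vertices \<open>p\<close> and \<open>Suc p\<close>.\<close>

definition pineapple_form :: "nat \<Rightarrow> (nat \<Rightarrow> real) \<Rightarrow> (nat \<Rightarrow> real) \<Rightarrow> real" where
  "pineapple_form p x y =
     (\<Sum>k<p. x k) * (\<Sum>k<p. y k) - (\<Sum>k<p. x k * y k)
     + x 0 * (y p + y (Suc p)) + (x p + x (Suc p)) * y 0"

definition dot :: "nat \<Rightarrow> (nat \<Rightarrow> real) \<Rightarrow> (nat \<Rightarrow> real) \<Rightarrow> real" where
  "dot p x y = (\<Sum>k<p. x k * y k) + x p * y p + x (Suc p) * y (Suc p)"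

lemma pineapple_form_eq:
  assumes "p \<ge> 1"
  shows "(\<Sum>k\<in>pverts (pineapple p 2). \<Sum>l\<in>pverts (pineapple p 2).
           x k * y l * of_bool ((k, l) \<in> parcs (pineapple p 2))) = pineapple_form p x y"
proof -
  have split: "(\<Sum>k\<in>pverts (pineapple p 2). f k) = (\<Sum>k<p. f k) + f p + f (Suc p)" for f :: "nat \<Rightarrow> real"
    by (simp add: pineapple_def atLeast0LessThan)
  have inner: "(\<Sum>l<p. x k * y l * of_bool ((k, l) \<in> parcs (pineapple p 2))) =
      x k * (\<Sum>l<p. y l) - x k * y k" if "k < p" for k
  proof -
    have "(\<Sum>l<p. x k * y l * of_bool ((k, l) \<in> parcs (pineapple p 2))) =
        (\<Sum>l<p. x k * y l - (if l = k then x k * y l else 0))"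
      using that by (intro sum.cong refl) (auto simp: pineapple_def)
    then show ?thesis
      using that by (simp add: sum_subtractf sum_distrib_left)
  qed
  have outer: "(\<Sum>l<p. x k * y l * of_bool ((k, l) \<in> parcs (pineapple p 2))) = x k * y 0"
    if "k \<in> {p, Suc p}" for k
  proof -
    have "(\<Sum>l<p. x k * y l * of_bool ((k, l) \<in> parcs (pineapple p 2))) =
        (\<Sum>l<p. if l = 0 then x k * y l else 0)"
      using that by (intro sum.cong refl) (auto simp: pineapple_def)
    then show ?thesis
      using assms by simp
  qed
  have pend: "(\<Sum>k<p. x k * z * of_bool ((k, l) \<in> parcs (pineapple p 2))) = x 0 * z"
    if "l \<in> {p, Suc p}" for l z
  proof -
    have "(\<Sum>k<p. x k * z * of_bool ((k, l) \<in> parcs (pineapple p 2))) =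
        (\<Sum>k<p. if k = 0 then x k * z else 0)"
      using that by (intro sum.cong refl) (auto simp: pineapple_def)
    then show ?thesis
      using assms by simp
  qed
  have none: "(k, l) \<notin> parcs (pineapple p 2)" if "k \<in> {p, Suc p}" "l \<in> {p, Suc p}" for k l
    using that assms by (auto simp: pineapple_def)
  show ?thesis
    unfolding split
    by (simp add: sum.distrib inner outer pend none sum_subtractf
        del: sum_mult_of_bool_eq sum_of_bool_mult_eq flip: sum_distrib_right)
      (simp add: pineapple_form_def algebra_simps)
qed

lemma dot_eq: "(\<Sum>k\<in>pverts (pineapple p 2). x k * y k) = dot p x y"
  by (simp add: pineapple_def dot_def atLeast0LessThan)

text \<open>
  The matrix \<open>A + I\<close> of \<open>K\<^sub>p\<^sup>2\<close> has rank 4 and signature (3, 1).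
\<close>

lemma pineapple_form_lorentz:
  "pineapple_form p x y + dot p x y =
     (\<Sum>k<p. x k) * (\<Sum>k<p. y k) + (x p + x 0) * (y p + y 0)
     + (x (Suc p) + x 0) * (y (Suc p) + y 0) - 2 * (x 0 * y 0)"
  by (simp add: pineapple_form_def dot_def algebra_simps)

text \<open>The equality case of the two sums of squares below, where \<open>t\<close> is -1/2 and 1
  respectively.\<close>

lemma dot_eq_0I:
  assumes "p \<ge> 1" "(\<Sum>k<p. z k) = 0" "(\<Sum>k=1..<p. (z k)\<^sup>2) = 0" "z p = t * z 0" "z (Suc p) = t * z 0"
  shows "dot p z z = 0"
proof -
  have rest: "z k = 0" if "k \<in> {1..<p}" for k
    using that assms(3) by (subst (asm) sum_nonneg_eq_0_iff) auto
  have "(\<Sum>k<p. z k) = z 0 + (\<Sum>k=1..<p. z k)"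
    using assms(1) by (simp add: sum.atLeast_Suc_lessThan flip: atLeast0LessThan)
  with rest assms(2) have "z 0 = 0"
    by simp
  with rest have "z k = 0" if "k < p" for k
    using that by (cases "k = 0") auto
  with \<open>z 0 = 0\<close> assms(4,5) show ?thesis
    by (simp add: dot_def)
qed

text \<open>Completing squares makes A + 2I a sum of squares and, on the hyperplane where the clique
  coordinates sum to zero, A - I minus a sum of squares. Every plane meets this hyperplane
  nontrivially, so the latter bounds the second largest eigenvalue.\<close>

lemma
  assumes p: "p \<ge> 1"
  shows smallest_eigenvalue_gt: "pineapple_form p z z + 2 * dot p z z \<le> 0 \<Longrightarrow> dot p z z = 0"
    and second_eigenvalue_less: "(\<Sum>k<p. z k) = 0 \<Longrightarrow> pineapple_form p z z \<ge> dot p z z \<Longrightarrow> dot p z z = 0"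
proof -
  let ?S = "\<Sum>k<p. z k" and ?R = "\<Sum>k=1..<p. (z k)\<^sup>2"
  have R: "?R \<ge> 0"
    by (rule sum_nonneg) auto
  have sq: "(\<Sum>k<p. z k * z k) = (z 0)\<^sup>2 + ?R"
    using p by (simp add: sum.atLeast_Suc_lessThan power2_eq_square flip: atLeast0LessThan)
  show "dot p z z = 0" if "pineapple_form p z z + 2 * dot p z z \<le> 0"
  proof -
    have "pineapple_form p z z + 2 * dot p z z =
        ?S\<^sup>2 + ?R + 2 * (z p + z 0 / 2)\<^sup>2 + 2 * (z (Suc p) + z 0 / 2)\<^sup>2"
      unfolding pineapple_form_def dot_def sq by (simp add: power2_eq_square field_simps)
    with that R have "?S\<^sup>2 = 0 \<and> ?R = 0 \<and> (z p + z 0 / 2)\<^sup>2 = 0 \<and> (z (Suc p) + z 0 / 2)\<^sup>2 = 0"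
      using zero_le_power2[of ?S] zero_le_power2[of "z p + z 0 / 2"] zero_le_power2[of "z (Suc p) + z 0 / 2"]
      by linarith
    then show ?thesis
      by (intro dot_eq_0I[OF p, of z "- 1 / 2"]) auto
  qed
  show "dot p z z = 0" if "?S = 0" "pineapple_form p z z \<ge> dot p z z"
  proof -
    have "pineapple_form p z z - dot p z z = - 2 * ?R - (z p - z 0)\<^sup>2 - (z (Suc p) - z 0)\<^sup>2"
      unfolding pineapple_form_def dot_def sq that(1) by (simp add: power2_eq_square field_simps)
    with that(2) R have "?R = 0 \<and> (z p - z 0)\<^sup>2 = 0 \<and> (z (Suc p) - z 0)\<^sup>2 = 0"
      using zero_le_power2[of "z p - z 0"] zero_le_power2[of "z (Suc p) - z 0"]
      by linarith
    then show ?thesis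
      using that(1) by (intro dot_eq_0I[OF p, of z 1]) auto
  qed
qed

lemma
  shows pineapple_form_add: "pineapple_form p (\<lambda>k. x k + x' k) y = pineapple_form p x y + pineapple_form p x' y"
    and pineapple_form_scale: "pineapple_form p (\<lambda>k. c * x k) y = c * pineapple_form p x y"
    and pineapple_form_commute: "pineapple_form p x y = pineapple_form p y x"
    and dot_add: "dot p (\<lambda>k. x k + x' k) y = dot p x y + dot p x' y"
    and dot_scale: "dot p (\<lambda>k. c * x k) y = c * dot p x y"
    and dot_commute: "dot p x y = dot p y x"
  by (simp_all add: pineapple_form_def dot_def algebra_simps sum.distrib flip: sum_distrib_left)

lemma
  shows pineapple_form_add_right: "pineapple_form p y (\<lambda>k. x k + x' k) = pineapple_form p y x + pineapple_form p y x'"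
    and pineapple_form_scale_right: "pineapple_form p y (\<lambda>k. c * x k) = c * pineapple_form p y x"
    and dot_add_right: "dot p y (\<lambda>k. x k + x' k) = dot p y x + dot p y x'"
    and dot_scale_right: "dot p y (\<lambda>k. c * x k) = c * dot p y x"
  by (simp_all add: pineapple_form_commute[of p y] dot_commute[of p y]
      pineapple_form_add pineapple_form_scale dot_add dot_scale)

lemmas bilinear_simps = pineapple_form_add pineapple_form_scale dot_add dot_scale
  pineapple_form_add_right pineapple_form_scale_right dot_add_right dot_scale_right

section \<open>Arcs and triangles of the pineapple graph\<close>

lemma card_off_diagonal:
  assumes "finite A"
  shows "card {(a, b). a \<in> A \<and> b \<in> A \<and> a \<noteq> b} = card A * (card A - 1)"
proof -
  have "{(a, b). a \<in> A \<and> b \<in> A \<and> a \<noteq> b} = (SIGMA a:A. A - {a})"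
    by auto
  then show ?thesis
    using assms by simp
qed

lemma card_parcs_pineapple:
  assumes "p \<ge> 1"
  shows "card (parcs (pineapple p 2)) = p * (p - 1) + 4"
proof -
  let ?C = "{(i, j). i \<in> {..<p} \<and> j \<in> {..<p} \<and> i \<noteq> j}"
  have fin: "finite ?C"
    by (rule finite_subset[of _ "{..<p} \<times> {..<p}"]) auto
  have "parcs (pineapple p 2) = ?C \<union> {(0, p), (0, Suc p), (p, 0), (Suc p, 0)}"
    by (auto simp: pineapple_def)
  moreover have "card (?C \<union> {(0, p), (0, Suc p), (p, 0), (Suc p, 0)}) = card ?C + 4"
    using assms fin by (subst card_Un_disjoint) auto
  ultimately show ?thesis
    using card_off_diagonal[of "{..<p}"] by simp
qed

definition distinct_triples :: "'a set \<Rightarrow> ('a \<times> 'a \<times> 'a) set" where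
  "distinct_triples A = {(a, b, c). {a, b, c} \<subseteq> A \<and> a \<noteq> b \<and> b \<noteq> c \<and> c \<noteq> a}"

lemma finite_distinct_triples: "finite A \<Longrightarrow> finite (distinct_triples A)"
  by (rule finite_subset[of _ "A \<times> A \<times> A"]) (auto simp: distinct_triples_def)

text \<open>A bijection transports the triples. This compares the triangles inside a clique of
  \<open>G\<close> with those of the pineapple without evaluating their number.\<close>

lemma card_distinct_triples_cong:
  assumes "finite A" "finite B" "card A = card B"
  shows "card (distinct_triples A) = card (distinct_triples B)"
proof -
  obtain f where f: "bij_betw f A B"
    using assms finite_same_card_bij by blast
  have "inv_into A f x = inv_into A f y \<longleftrightarrow> x = y" if "x \<in> B" "y \<in> B" for x y
    using f that by (metis bij_betw_inv_into_right)
  with f have "bij_betw (\<lambda>(a, b, c). (f a, f b, f c)) (distinct_triples A) (distinct_triples B)"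
    by (intro bij_betw_byWitness[where f' = "\<lambda>(a, b, c). (inv_into A f a, inv_into A f b, inv_into A f c)"])
      (auto simp: distinct_triples_def bij_betw_inv_into_left bij_betw_inv_into_right bij_betw_apply
        bij_betw_apply[OF bij_betw_inv_into] inj_on_eq_iff[OF bij_betw_imp_inj_on])
  then show ?thesis
    by (rule bij_betw_same_card)
qed

text \<open>A pendant vertex has a single neighbour, so every triangle lies in the clique.\<close>

lemma triangles_pineapple: "p \<ge> 1 \<Longrightarrow> triangles (pineapple p 2) = distinct_triples {..<p}"
  by (auto simp: triangles_def pineapple_def distinct_triples_def)

section \<open>Graphs cospectral with the pineapple graph\<close>

text \<open>What is retained of cospectrality: an orthonormal family on which the form of the
  pineapple takes the entries of the adjacency matrix of \<open>G\<close>, together with the counts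
  of vertices, arcs and triangles.\<close>

locale pineapple_mate = pair_graph G for G :: "'v pair_pre_digraph" +
  fixes p :: nat and y :: "'v \<Rightarrow> nat \<Rightarrow> real"
  assumes p3: "p \<ge> 3"
    and dot_y: "u \<in> pverts G \<Longrightarrow> v \<in> pverts G \<Longrightarrow> dot p (y u) (y v) = of_bool (u = v)"
    and form_y: "u \<in> pverts G \<Longrightarrow> v \<in> pverts G \<Longrightarrow>
      pineapple_form p (y u) (y v) = of_bool ((u, v) \<in> parcs G)"
    and card_verts: "card (pverts G) = p + 2"
    and card_arcs: "card (parcs G) = p * (p - 1) + 4"
    and card_triangles: "card (triangles G) = card (distinct_triples {..<p})"
begin

section \<open>Induced subgraphs excluded by the eigenvalues, the signature and the rank\<close>

abbreviation adj :: "'v \<Rightarrow> 'v \<Rightarrow> bool" where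
  "adj u v \<equiv> (u, v) \<in> parcs G"

text \<open>The entries of A + I, for A the adjacency matrix of \<open>G\<close>.\<close>

definition adj_eq :: "'v \<Rightarrow> 'v \<Rightarrow> real" where
  "adj_eq u v = of_bool (adj u v \<or> u = v)"

lemma not_adj_self [simp]: "\<not> adj u u"
  using no_loops' by blast

text \<open>This presents A + I as a Gram matrix of vectors with four coordinates, three counted
  positively and the last, \<open>y u 0\<close>, negatively.\<close>

lemma adj_eq_lorentz:
  assumes "u \<in> pverts G" "v \<in> pverts G"
  shows "adj_eq u v = (\<Sum>k<p. y u k) * (\<Sum>k<p. y v k) + (y u p + y u 0) * (y v p + y v 0)
     + (y u (Suc p) + y u 0) * (y v (Suc p) + y v 0) - 2 * (y u 0 * y v 0)"
  unfolding pineapple_form_lorentz[symmetric] form_y[OF assms] dot_y[OF assms]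
  by (auto simp: adj_eq_def)

text \<open>The alternating vector on a four-cycle is an eigenvector for -2, against
  \<open>smallest_eigenvalue_gt\<close>.\<close>

lemma no_induced_C4:
  assumes V: "{v1, v2, v3, v4} \<subseteq> pverts G" and "v1 \<noteq> v3" "v2 \<noteq> v4"
    and adj: "adj v1 v2" "adj v2 v3" "adj v3 v4" "adj v4 v1" "\<not> adj v1 v3" "\<not> adj v2 v4"
  shows False
proof -
  define z where "z k = y v1 k + (-1) * y v2 k + (y v3 k + (-1) * y v4 k)" for k
  have ne: "v1 \<noteq> v2" "v2 \<noteq> v3" "v3 \<noteq> v4" "v4 \<noteq> v1"
    using adj by auto
  have adj': "adj v2 v1" "adj v3 v2" "adj v4 v3" "adj v1 v4" "\<not> adj v3 v1" "\<not> adj v4 v2"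
    using adj by (metis arc_sym)+
  note [simp] = assms(2,3) assms(2,3)[symmetric] ne ne[symmetric] adj adj'
  have "dot p z z = 4"
    unfolding z_def bilinear_simps using V by (simp add: dot_y)
  moreover have "pineapple_form p z z = - 8"
    unfolding z_def bilinear_simps using V by (simp add: form_y)
  ultimately show False
    using smallest_eigenvalue_gt[of p z] p3 by simp
qed

text \<open>On the plane spanned by the sums over the two edges, the form agrees with
  \<open>dot\<close>. A nonzero vector of this plane has zero clique sum, against
  \<open>second_eigenvalue_less\<close>.\<close>

lemma no_induced_2K2:
  assumes V: "{v1, v2, v3, v4} \<subseteq> pverts G" and "v1 \<noteq> v3" "v1 \<noteq> v4" "v2 \<noteq> v3" "v2 \<noteq> v4"
    and adj: "adj v1 v2" "adj v3 v4" "\<not> adj v1 v3" "\<not> adj v1 v4" "\<not> adj v2 v3" "\<not> adj v2 v4"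
  shows False
proof -
  define s where "s u = (\<Sum>k<p. y u k)" for u
  \<comment> \<open>One linear condition in two unknowns has a nonzero solution.\<close>
  obtain a b :: real where ab: "a \<noteq> 0 \<or> b \<noteq> 0" "a * (s v1 + s v2) + b * (s v3 + s v4) = 0"
  proof (cases "s v1 + s v2 = 0")
    case True
    then show ?thesis by (intro that[of 1 0]) auto
  next
    case False
    then show ?thesis by (intro that[of "- (s v3 + s v4)" "s v1 + s v2"]) (auto simp: algebra_simps)
  qed
  define z where "z k = a * (y v1 k + y v2 k) + b * (y v3 k + y v4 k)" for k
  have ne: "v1 \<noteq> v2" "v3 \<noteq> v4"
    using adj by auto
  have adj': "adj v2 v1" "adj v4 v3" "\<not> adj v3 v1" "\<not> adj v4 v1" "\<not> adj v3 v2" "\<not> adj v4 v2"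
    using adj by (metis arc_sym)+
  note [simp] = assms(2-5) assms(2-5)[symmetric] ne ne[symmetric] adj adj'
  have "(\<Sum>k<p. z k) = 0"
    using ab(2) by (simp add: z_def s_def sum.distrib flip: sum_distrib_left)
  moreover have dot: "dot p z z = 2 * a\<^sup>2 + 2 * b\<^sup>2"
    unfolding z_def bilinear_simps using V by (simp add: dot_y power2_eq_square)
  moreover have "pineapple_form p z z = 2 * a\<^sup>2 + 2 * b\<^sup>2"
    unfolding z_def bilinear_simps using V by (simp add: form_y power2_eq_square)
  ultimately have "2 * a\<^sup>2 + 2 * b\<^sup>2 = 0"
    using second_eigenvalue_less[of p z] p3 by simp
  then have "a\<^sup>2 + b\<^sup>2 = 0"
    by linarith
  with ab(1) show False
    by (simp add: sum_power2_eq_zero_iff)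
qed

text \<open>On four pairwise non-adjacent vertices A + I is the identity, but the signature (3, 1)
  allows no positive definite subspace of dimension 4.\<close>

lemma no_independent_4_set:
  assumes V: "{v1, v2, v3, v4} \<subseteq> pverts G" and "distinct [v1, v2, v3, v4]"
    and adj: "\<not> adj v1 v2" "\<not> adj v1 v3" "\<not> adj v1 v4" "\<not> adj v2 v3" "\<not> adj v2 v4" "\<not> adj v3 v4"
  shows False
proof -
  define vs where "vs i = [v1, v2, v3, v4] ! i" for i
  \<comment> \<open>Only the three positive Lorentz coordinates are made to vanish; the form at the
    resulting \<open>z\<close> is then at most 0.\<close>
  define f where "f j i = [(\<Sum>k<p. y (vs i) k), y (vs i) p + y (vs i) 0, y (vs i) (Suc p) + y (vs i) 0] ! j"
    for i j
  obtain c where c0: "\<exists>i\<le>3. c i \<noteq> 0" and c: "\<And>j. j < 3 \<Longrightarrow> (\<Sum>i\<le>3. f j i * c i) = 0"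
    using homogeneous_system_nontrivial_solution[of 3 f] by blast
  define z where "z k = c 0 * y v1 k + c 1 * y v2 k + (c 2 * y v3 k + c 3 * y v4 k)" for k
  have adj': "\<not> adj v2 v1" "\<not> adj v3 v1" "\<not> adj v4 v1" "\<not> adj v3 v2" "\<not> adj v4 v2" "\<not> adj v4 v3"
    using adj by (metis arc_sym)+
  have ne: "v1 \<noteq> v2" "v1 \<noteq> v3" "v1 \<noteq> v4" "v2 \<noteq> v3" "v2 \<noteq> v4" "v3 \<noteq> v4"
    using assms(2) by auto
  note [simp] = ne ne[symmetric] adj adj'
  have S: "(\<Sum>i\<le>3. g i) = g 0 + g 1 + g 2 + g 3" for g :: "nat \<Rightarrow> real"
    by (simp add: eval_nat_numeral)
  have "(\<Sum>k<p. z k) = c 0 * (\<Sum>k<p. y v1 k) + c 1 * (\<Sum>k<p. y v2 k)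
      + (c 2 * (\<Sum>k<p. y v3 k) + c 3 * (\<Sum>k<p. y v4 k))"
    by (simp add: z_def sum.distrib flip: sum_distrib_left)
  then have "(\<Sum>k<p. z k) = 0" "z p + z 0 = 0" "z (Suc p) + z 0 = 0"
    using c[of 0] c[of 1] c[of 2]
    by (simp_all add: S f_def vs_def z_def algebra_simps)
  then have "pineapple_form p z z + dot p z z = - 2 * (z 0)\<^sup>2"
    unfolding pineapple_form_lorentz by (simp add: power2_eq_square)
  moreover have "dot p z z = (c 0)\<^sup>2 + (c 1)\<^sup>2 + (c 2)\<^sup>2 + (c 3)\<^sup>2"
    unfolding z_def bilinear_simps using V by (simp add: dot_y power2_eq_square)
  moreover have "pineapple_form p z z = 0"
    unfolding z_def bilinear_simps using V by (simp add: form_y)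
  ultimately have "(c 0)\<^sup>2 + (c 1)\<^sup>2 + (c 2)\<^sup>2 + (c 3)\<^sup>2 \<le> 0"
    using zero_le_power2[of "z 0"] by linarith
  then have "(c 0)\<^sup>2 = 0 \<and> (c 1)\<^sup>2 = 0 \<and> (c 2)\<^sup>2 = 0 \<and> (c 3)\<^sup>2 = 0"
    using zero_le_power2[of "c 0"] zero_le_power2[of "c 1"] zero_le_power2[of "c 2"] zero_le_power2[of "c 3"]
    by linarith
  moreover obtain i where "i \<le> 3" "c i \<noteq> 0"
    using c0 by blast
  moreover have "i = 0 \<or> i = 1 \<or> i = 2 \<or> i = 3"
    using \<open>i \<le> 3\<close> by linarith
  ultimately show False
    by auto
qed

text \<open>Five vectors of Lorentz coordinates are linearly dependent, and the same relation holds
  between the columns of A + I. A nonsingular submatrix of order 5 is thereby excluded.\<close>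

lemma rank_le_4:
  assumes V: "{v1, v2, v3, v4, v5} \<subseteq> pverts G"
  obtains c1 c2 c3 c4 c5 where "\<not> (c1 = 0 \<and> c2 = 0 \<and> c3 = 0 \<and> c4 = 0 \<and> c5 = 0)"
    "\<And>w. w \<in> pverts G \<Longrightarrow>
      adj_eq w v1 * c1 + adj_eq w v2 * c2 + adj_eq w v3 * c3 + adj_eq w v4 * c4 + adj_eq w v5 * c5 = 0"
proof -
  define vs where "vs i = [v1, v2, v3, v4, v5] ! i" for i
  define f where "f j i = [(\<Sum>k<p. y (vs i) k), y (vs i) p + y (vs i) 0, y (vs i) (Suc p) + y (vs i) 0, y (vs i) 0] ! j"
    for i j
  obtain c where c0: "\<exists>i\<le>4. c i \<noteq> 0" and c: "\<And>j. j < 4 \<Longrightarrow> (\<Sum>i\<le>4. f j i * c i) = 0"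
    using homogeneous_system_nontrivial_solution[of 4 f] by blast
  have S: "(\<Sum>i\<le>4. g i) = g 0 + g 1 + g 2 + g 3 + g 4" for g :: "nat \<Rightarrow> real"
    by (simp add: eval_nat_numeral)
  show thesis
  proof (rule that)
    obtain i where "i \<le> 4" "c i \<noteq> 0"
      using c0 by blast
    moreover have "i = 0 \<or> i = 1 \<or> i = 2 \<or> i = 3 \<or> i = 4"
      using \<open>i \<le> 4\<close> by linarith
    ultimately show "\<not> (c 0 = 0 \<and> c 1 = 0 \<and> c 2 = 0 \<and> c 3 = 0 \<and> c 4 = 0)"
      by auto
    fix w assume w: "w \<in> pverts G"
    \<comment> \<open>The coefficient -2 of the negative square is absorbed into the row vector of
      \<open>w\<close>.\<close>
    define g where "g = [(\<Sum>k<p. y w k), y w p + y w 0, y w (Suc p) + y w 0, - 2 * y w 0]"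
    have vs: "vs i \<in> pverts G" if "i \<le> 4" for i
    proof -
      have "i = 0 \<or> i = 1 \<or> i = 2 \<or> i = 3 \<or> i = 4"
        using that by linarith
      then show ?thesis using V by (auto simp: vs_def)
    qed
    have "adj_eq w v1 * c 0 + adj_eq w v2 * c 1 + adj_eq w v3 * c 2 + adj_eq w v4 * c 3 + adj_eq w v5 * c 4
        = (\<Sum>i\<le>4. adj_eq w (vs i) * c i)"
      by (simp add: S vs_def)
    also have "\<dots> = (\<Sum>i\<le>4. (\<Sum>j<4. g ! j * f j i) * c i)"
      using w vs by (intro sum.cong refl) (simp add: adj_eq_lorentz g_def f_def eval_nat_numeral)
    also have "\<dots> = (\<Sum>j<4. g ! j * (\<Sum>i\<le>4. f j i * c i))"
      unfolding sum_distrib_left sum_distrib_right by (subst sum.swap) (simp add: mult.assoc)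
    also have "\<dots> = 0"
      using c by (intro sum.neutral) auto
    finally show "adj_eq w v1 * c 0 + adj_eq w v2 * c 1 + adj_eq w v3 * c 2 + adj_eq w v4 * c 3 + adj_eq w v5 * c 4 = 0" .
  qed
qed

text \<open>For the five-cycle A + I is nonsingular, which rank 4 forbids.\<close>

lemma no_induced_C5:
  assumes V: "{v1, v2, v3, v4, v5} \<subseteq> pverts G" and dist: "distinct [v1, v2, v3, v4, v5]"
    and adj: "adj v1 v2" "adj v2 v3" "adj v3 v4" "adj v4 v5" "adj v5 v1"
      "\<not> adj v1 v3" "\<not> adj v1 v4" "\<not> adj v2 v4" "\<not> adj v2 v5" "\<not> adj v3 v5"
  shows False
proof -
  have adj': "adj v2 v1" "adj v3 v2" "adj v4 v3" "adj v5 v4" "adj v1 v5"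
      "\<not> adj v3 v1" "\<not> adj v4 v1" "\<not> adj v4 v2" "\<not> adj v5 v2" "\<not> adj v5 v3"
    using adj by (metis arc_sym)+
  obtain c1 c2 c3 c4 c5 where c: "\<not> (c1 = 0 \<and> c2 = 0 \<and> c3 = 0 \<and> c4 = 0 \<and> c5 = 0)"
    "\<And>w. w \<in> pverts G \<Longrightarrow>
      adj_eq w v1 * c1 + adj_eq w v2 * c2 + adj_eq w v3 * c3 + adj_eq w v4 * c4 + adj_eq w v5 * c5 = 0"
    using rank_le_4[OF V] by blast
  have "c1 + c2 + c5 = 0" "c1 + c2 + c3 = 0" "c2 + c3 + c4 = 0" "c3 + c4 + c5 = 0" "c1 + c4 + c5 = 0"
    using c(2)[of v1] c(2)[of v2] c(2)[of v3] c(2)[of v4] c(2)[of v5] V dist adj adj'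
    by (auto simp: adj_eq_def)
  then have "c1 = 0 \<and> c2 = 0 \<and> c3 = 0 \<and> c4 = 0 \<and> c5 = 0"
    by linarith
  with c(1) show False ..
qed

text \<open>The bull is the triangle \<open>a\<close>, \<open>b\<close>, \<open>w\<close> with
  pendant vertices \<open>d\<close> at \<open>a\<close> and \<open>e\<close> at \<open>b\<close>;
  here too A + I is nonsingular.\<close>

lemma no_induced_bull:
  assumes V: "{d, e, a, b, w} \<subseteq> pverts G" and dist: "distinct [d, e, a, b, w]"
    and adj: "adj a b" "adj b w" "adj a w" "adj d a" "adj e b"
      "\<not> adj d e" "\<not> adj d b" "\<not> adj d w" "\<not> adj e a" "\<not> adj e w"
  shows False
proof -
  have adj': "adj b a" "adj w b" "adj w a" "adj a d" "adj b e"
      "\<not> adj e d" "\<not> adj b d" "\<not> adj w d" "\<not> adj a e" "\<not> adj w e"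
    using adj by (metis arc_sym)+
  obtain c1 c2 c3 c4 c5 where c: "\<not> (c1 = 0 \<and> c2 = 0 \<and> c3 = 0 \<and> c4 = 0 \<and> c5 = 0)"
    "\<And>x. x \<in> pverts G \<Longrightarrow>
      adj_eq x d * c1 + adj_eq x e * c2 + adj_eq x a * c3 + adj_eq x b * c4 + adj_eq x w * c5 = 0"
    using rank_le_4[OF V] by blast
  have "c1 + c3 = 0" "c2 + c4 = 0" "c1 + c3 + c4 + c5 = 0" "c2 + c3 + c4 + c5 = 0" "c3 + c4 + c5 = 0"
    using c(2)[of d] c(2)[of e] c(2)[of a] c(2)[of b] c(2)[of w] V dist adj adj'
    by (auto simp: adj_eq_def)
  then have "c1 = 0 \<and> c2 = 0 \<and> c3 = 0 \<and> c4 = 0 \<and> c5 = 0"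
    by linarith
  with c(1) show False ..
qed

text \<open>
  The Schur complement of the identity block of three pairwise non-adjacent vertices has rank 1.
\<close>

lemma independent_3_set_minor:
  assumes V: "{v1, v2, v3, x, z} \<subseteq> pverts G" and dist: "distinct [v1, v2, v3, x]" "z \<notin> {v1, v2, v3}"
    and adj: "\<not> adj v1 v2" "\<not> adj v1 v3" "\<not> adj v2 v3" "adj x z \<or> x = z"
  defines "n \<equiv> \<lambda>u w. adj_eq v1 u * adj_eq v1 w + adj_eq v2 u * adj_eq v2 w + adj_eq v3 u * adj_eq v3 w"
  shows "(1 - n x x) * (1 - n z z) = (1 - n x z)\<^sup>2"
proof (cases "x = z")
  case True
  then show ?thesis by (simp add: power2_eq_square)
next
  case False
  have adj': "\<not> adj v2 v1" "\<not> adj v3 v1" "\<not> adj v3 v2" "adj x z" "adj z x"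
    using adj False by (metis arc_sym)+
  obtain c1 c2 c3 c4 c5 where c: "\<not> (c1 = 0 \<and> c2 = 0 \<and> c3 = 0 \<and> c4 = 0 \<and> c5 = 0)"
    "\<And>w. w \<in> pverts G \<Longrightarrow>
      adj_eq w v1 * c1 + adj_eq w v2 * c2 + adj_eq w v3 * c3 + adj_eq w x * c4 + adj_eq w z * c5 = 0"
    using rank_le_4[OF V] by blast
  have sym: "adj_eq u w = adj_eq w u" for u w
    using arc_sym by (auto simp: adj_eq_def)
  have one: "adj_eq u u = 1" "adj_eq x z = 1" for u
    using adj' by (auto simp: adj_eq_def)
  have zero: "adj_eq v1 v2 = 0" "adj_eq v1 v3 = 0" "adj_eq v2 v3 = 0"
    using adj dist by (auto simp: adj_eq_def)
  define x1 x2 x3 z1 z2 z3 where defs: "x1 = adj_eq v1 x" "x2 = adj_eq v2 x" "x3 = adj_eq v3 x"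
    "z1 = adj_eq v1 z" "z2 = adj_eq v2 z" "z3 = adj_eq v3 z"
  \<comment> \<open>The rows of the three independent vertices eliminate their own coefficients,
    which leaves the 2 by 2 Schur complement.\<close>
  have c123: "c1 = - (x1 * c4 + z1 * c5)" "c2 = - (x2 * c4 + z2 * c5)" "c3 = - (x3 * c4 + z3 * c5)"
    using c(2)[of v1] c(2)[of v2] c(2)[of v3] V zero sym[of v2 v1] sym[of v3 v1] sym[of v3 v2]
    by (auto simp: defs one)
  have "x1 * c1 + x2 * c2 + x3 * c3 + c4 + c5 = 0" "z1 * c1 + z2 * c2 + z3 * c3 + c4 + c5 = 0"
    using c(2)[of x] c(2)[of z] V sym[of x v1] sym[of x v2] sym[of x v3] sym[of z v1] sym[of z v2] sym[of z v3]
      sym[of z x]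
    by (auto simp: defs one)
  then have eqs: "(1 - n x x) * c4 + (1 - n x z) * c5 = 0" "(1 - n x z) * c4 + (1 - n z z) * c5 = 0"
    unfolding c123 n_def defs by (simp_all add: algebra_simps)
  \<comment> \<open>The determinant of a symmetric 2 by 2 matrix annihilates every vector of its
    kernel.\<close>
  have cramer: "(P * R - Q\<^sup>2) * a = 0" "(P * R - Q\<^sup>2) * b = 0"
    if "P * a + Q * b = 0" "Q * a + R * b = 0" for P Q R a b :: real
  proof -
    have "(P * R - Q\<^sup>2) * a = R * (P * a + Q * b) - Q * (Q * a + R * b)"
      "(P * R - Q\<^sup>2) * b = P * (Q * a + R * b) - Q * (P * a + Q * b)"
      by (simp_all add: algebra_simps power2_eq_square)
    then show "(P * R - Q\<^sup>2) * a = 0" "(P * R - Q\<^sup>2) * b = 0"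
      unfolding that by simp_all
  qed
  note cramer[OF eqs]
  moreover have "c4 \<noteq> 0 \<or> c5 \<noteq> 0"
    using c(1) c123 by auto
  ultimately show ?thesis
    by auto
qed

section \<open>Cliques and the split partition\<close>

definition clique :: "'v set \<Rightarrow> bool" where
  "clique K \<longleftrightarrow> K \<subseteq> pverts G \<and> (\<forall>u\<in>K. \<forall>v\<in>K. u \<noteq> v \<longrightarrow> adj u v)"

lemma adj_sym: "adj u v \<Longrightarrow> adj v u"
  using arc_sym by metis

lemma finite_nbrs: "finite {v. adj u v}"
  by (rule finite_subset[OF _ pair_finite_verts]) (auto dest: in_arcsD2)

lemma clique_swap:
  assumes K: "clique K" and "a \<in> K" "x \<in> pverts G" "x \<notin> K" "\<forall>v\<in>K - {a}. adj x v"
  shows "clique (insert x (K - {a}))" "card (insert x (K - {a})) = card K"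
proof -
  have fin: "finite K"
    using K finite_subset[OF _ pair_finite_verts] by (auto simp: clique_def)
  show "card (insert x (K - {a})) = card K"
    using assms fin card_Suc_Diff1[OF fin] by simp
  show "clique (insert x (K - {a}))"
    using assms adj_sym by (auto simp: clique_def)
qed

text \<open>
  Among the maximum cliques, one with the largest degree sum has an independent complement, because
  \<open>2K\<^sub>2\<close>, \<open>C\<^sub>4\<close> and \<open>C\<^sub>5\<close> are not induced subgraphs.
\<close>

lemma split_partition:
  obtains K where "clique K" "\<And>L. clique L \<Longrightarrow> card L \<le> card K"
    "\<And>u v. u \<in> pverts G - K \<Longrightarrow> v \<in> pverts G - K \<Longrightarrow> \<not> adj u v"
proof -
  have bound: "card L \<le> card (pverts G)" if "clique L" for L
    using that card_mono[OF pair_finite_verts] by (auto simp: clique_def)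
  define deg where "deg u = card {v. adj u v}" for u
  obtain M where M: "clique M" "\<And>L. clique L \<Longrightarrow> card L \<le> card M"
    using ex_has_greatest_nat[of clique "{}" card "Suc (card (pverts G))"] bound
    by (auto simp: clique_def less_Suc_eq_le)
  have "(\<Sum>u\<in>L. deg u) < Suc (\<Sum>u\<in>pverts G. deg u)" if "clique L" for L
    using that pair_finite_verts by (auto simp: clique_def less_Suc_eq_le intro!: sum_mono2)
  then obtain K where K: "clique K" "card K = card M"
    and K_deg: "\<And>L. clique L \<Longrightarrow> card L = card M \<Longrightarrow> (\<Sum>u\<in>L. deg u) \<le> (\<Sum>u\<in>K. deg u)"
    using ex_has_greatest_nat[of "\<lambda>L. clique L \<and> card L = card M" M "sum deg"] M(1) by metis
  have finK: "finite K"
    using K(1) finite_subset[OF _ pair_finite_verts] by (auto simp: clique_def)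
  have K_adj: "adj u v" if "u \<in> K" "v \<in> K" "u \<noteq> v" for u v
    using K(1) that by (auto simp: clique_def)
  have KV: "u \<in> pverts G" if "u \<in> K" for u
    using K(1) that by (auto simp: clique_def)
  \<comment> \<open>Otherwise \<open>x\<close> would enlarge a maximum clique.\<close>
  have nonadj: "\<exists>a\<in>K. \<not> adj x a" if "x \<in> pverts G - K" for x
  proof (rule ccontr)
    assume "\<not> (\<exists>a\<in>K. \<not> adj x a)"
    then have "clique (insert x K)"
      using K(1) that adj_sym by (auto simp: clique_def)
    then have "card (insert x K) \<le> card K"
      using M(2) K(2) by metis
    with that finK show False
      by simp
  qed
  \<comment> \<open>Otherwise \<open>x\<close>, \<open>z\<close> and one non-neighbour in
    \<open>K\<close> of each would induce a four-cycle.\<close>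
  have common: "\<exists>a\<in>K. \<not> adj x a \<and> \<not> adj z a"
    if x: "x \<in> pverts G - K" and z: "z \<in> pverts G - K" and xz: "adj x z" for x z
  proof (rule ccontr)
    assume none: "\<not> ?thesis"
    obtain a b where ab: "a \<in> K" "b \<in> K" "\<not> adj x a" "\<not> adj z b"
      using nonadj[OF x] nonadj[OF z] by blast
    have "a \<noteq> b" "adj z a" "adj x b"
      using none ab by auto
    then show False
      using no_induced_C4[of x z a b] x z xz ab K_adj KV by (auto dest: adj_sym)
  qed
  \<comment> \<open>Two common non-neighbours would form, with the edge from \<open>x\<close> to
    \<open>z\<close>, an induced \<open>2K_2\<close>.\<close>
  have unique: "a = b"
    if "x \<in> pverts G - K" "z \<in> pverts G - K" "adj x z" "a \<in> K" "b \<in> K"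
      "\<not> adj x a" "\<not> adj z a" "\<not> adj x b" "\<not> adj z b" for x z a b
    using no_induced_2K2[of x z a b] that K_adj KV by auto
  show thesis
  proof (rule that[OF K(1)])
    show "card L \<le> card K" if "clique L" for L
      using M(2)[OF that] K(2) by simp
    \<comment> \<open>If \<open>z\<close> misses all that \<open>x\<close> misses in
      \<open>K\<close>, then \<open>x\<close> misses only one vertex \<open>a\<close>. Exchanging
      \<open>a\<close> for \<open>x\<close> gives another maximum clique, so \<open>x\<close> has
      degree at most that of \<open>a\<close>.\<close>
    have no_edge: False
      if x: "x \<in> pverts G - K" and z: "z \<in> pverts G - K" and xz: "adj x z"
        and nested: "\<And>v. v \<in> K \<Longrightarrow> \<not> adj x v \<Longrightarrow> \<not> adj z v" for x z
    proof -
      obtain a where a: "a \<in> K" "\<not> adj x a" "\<not> adj z a"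
        using common[OF x z xz] by blast
      have x_adj: "adj x v" if "v \<in> K" "v \<noteq> a" for v
        using unique[OF x z xz a(1) that(1)] nested that a by blast
      let ?L = "insert x (K - {a})"
      have L: "clique ?L" "card ?L = card K"
        using clique_swap[OF K(1) a(1), of x] x x_adj by auto
      have "(\<Sum>u\<in>?L. deg u) = deg x + (\<Sum>u\<in>K - {a}. deg u)"
        using x finK by (subst sum.insert) auto
      moreover have "(\<Sum>u\<in>K. deg u) = deg a + (\<Sum>u\<in>K - {a}. deg u)"
        by (rule sum.remove[OF finK a(1)])
      ultimately have "deg x \<le> deg a"
        using K_deg[OF L(1)] L(2) K(2) by simp
      \<comment> \<open>As \<open>z\<close> is a neighbour of \<open>x\<close> but not of
        \<open>a\<close>, an inclusion of neighbourhoods would be strict. Hence \<open>a\<close> has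
        a neighbour \<open>w\<close> that \<open>x\<close> lacks, and \<open>a\<close>,
        \<open>w\<close>, \<open>z\<close>, \<open>x\<close> and a common non-neighbour
        \<open>b\<close> of \<open>w\<close> and \<open>z\<close> induce a five-cycle.\<close>
      moreover have "deg a < deg x" if "{v. adj a v} \<subseteq> {v. adj x v}"
        unfolding deg_def
        using that xz a adj_sym by (intro psubset_card_mono[OF finite_nbrs]) auto
      ultimately obtain w where w: "adj a w" "\<not> adj x w"
        by fastforce
      have w_out: "w \<in> pverts G - K"
        using w x_adj[of w] by (cases "w = a") (auto dest: in_arcsD2)
      have "w \<noteq> x" "w \<noteq> z"
        using w a adj_sym xz by auto
      have "adj w z"
        using no_induced_2K2[of a w x z] w a x z xz \<open>w \<noteq> x\<close> \<open>w \<noteq> z\<close> w_out KV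
        by (auto dest: adj_sym)
      then obtain b where b: "b \<in> K" "\<not> adj w b" "\<not> adj z b"
        using common[OF w_out z] by blast
      have "b \<noteq> a"
        using b w adj_sym by blast
      then have "adj x b" "adj a b"
        using x_adj b K_adj a by auto
      then show False
        using no_induced_C5[of a w z x b] w \<open>adj w z\<close> xz a b \<open>b \<noteq> a\<close> \<open>w \<noteq> x\<close> \<open>w \<noteq> z\<close> x z w_out KV
        by (auto dest: adj_sym)
    qed
    show "\<not> adj u v" if u: "u \<in> pverts G - K" and v: "v \<in> pverts G - K" for u v
    proof
      assume uv: "adj u v"
      \<comment> \<open>By \<open>no_edge\<close> neither endpoint's non-neighbours in
        \<open>K\<close> contain those of the other, which again yields an induced
        four-cycle.\<close>
      have "\<exists>w\<in>K. \<not> adj u w \<and> adj v w"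
        using no_edge[OF u v uv] by blast
      moreover have "\<exists>w\<in>K. \<not> adj v w \<and> adj u w"
        using no_edge[OF v u adj_sym[OF uv]] by blast
      ultimately obtain a b where ab: "a \<in> K" "\<not> adj u a" "adj v a" "b \<in> K" "\<not> adj v b" "adj u b"
        by blast
      then have "a \<noteq> b" by auto
      then show False
        using no_induced_C4[of u v a b] uv ab u v K_adj KV by (auto dest: adj_sym)
    qed
  qed
qed

section \<open>The vertices outside the clique and their edges\<close>

lemma independent_set_card_le:
  assumes SV: "S \<subseteq> pverts G" and indep: "\<And>u v. u \<in> S \<Longrightarrow> v \<in> S \<Longrightarrow> \<not> adj u v"
  shows "card S \<le> 3"
proof (rule ccontr)
  assume "\<not> card S \<le> 3"
  then have "4 \<le> card S"
    by simp
  then obtain T where T: "T \<subseteq> S" "card T = 4" "finite T"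
    by (rule obtain_subset_with_card_n)
  obtain vs where vs: "set vs = T" "distinct vs"
    using finite_distinct_list[OF T(3)] by blast
  have "length vs = Suc (Suc (Suc (Suc 0)))"
    using distinct_card[OF vs(2)] vs(1) T(2) by simp
  then obtain v1 v2 v3 v4 where eq: "vs = [v1, v2, v3, v4]"
    by (auto simp: length_Suc_conv)
  then have *: "v1 \<in> S" "v2 \<in> S" "v3 \<in> S" "v4 \<in> S"
    using vs(1) T(1) by auto
  show False
    by (rule no_independent_4_set[of v1 v2 v3 v4]) (use * SV vs(2) eq indep in auto)
qed

lemma card_clique_arcs: "clique K \<Longrightarrow> card K * (card K - 1) \<le> card (parcs G)"
proof -
  assume K: "clique K"
  then have "finite K"
    using finite_subset[OF _ pair_finite_verts] by (auto simp: clique_def)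
  moreover have "{(a, b). a \<in> K \<and> b \<in> K \<and> a \<noteq> b} \<subseteq> parcs G"
    using K by (auto simp: clique_def)
  from card_mono[OF pair_finite_arcs this] have "card {(a, b). a \<in> K \<and> b \<in> K \<and> a \<noteq> b} \<le> card (parcs G)" .
  ultimately show ?thesis
    by (simp only: card_off_diagonal)
qed

lemma pineapple_structure:
  obtains K a d e where "clique K" "card K = p" "a \<in> K" "d \<notin> K" "e \<notin> K" "d \<noteq> e"
    "pverts G = K \<union> {d, e}" "{v. adj d v} = {a}" "{v. adj e v} = {a}"
proof -
  obtain K where K: "clique K" "\<And>L. clique L \<Longrightarrow> card L \<le> card K"
    and indep: "\<And>u v. u \<in> pverts G - K \<Longrightarrow> v \<in> pverts G - K \<Longrightarrow> \<not> adj u v"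
    using split_partition by blast
  have KV: "K \<subseteq> pverts G" and K_adj: "\<And>u v. u \<in> K \<Longrightarrow> v \<in> K \<Longrightarrow> u \<noteq> v \<Longrightarrow> adj u v"
    using K(1) by (auto simp: clique_def)
  have finK: "finite K"
    using finite_subset[OF KV pair_finite_verts] .
  define S where "S = pverts G - K"
  have finS: "finite S" and SV: "S \<subseteq> pverts G" and SK: "S \<inter> K = {}"
    using pair_finite_verts by (auto simp: S_def)
  have VS: "pverts G = K \<union> S"
    using KV by (auto simp: S_def)
  have card_KS: "card K + card S = p + 2"
    using card_Un_disjoint[OF finK finS] SK card_verts VS by (simp add: Int_commute)
  have nonadj: "\<exists>v\<in>K. \<not> adj u v" if "u \<in> S" for u
  proof (rule ccontr)
    assume "\<not> (\<exists>v\<in>K. \<not> adj u v)"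
    then have "clique (insert u K)"
      using K(1) that adj_sym SV by (auto simp: clique_def)
    moreover have "u \<notin> K"
      using that SK by blast
    ultimately show False
      using K(2)[of "insert u K"] finK by simp
  qed
  have "card S \<noteq> 3"
  proof
    assume "card S = 3"
    then obtain v1 v2 v3 where S: "S = {v1, v2, v3}" and ne: "v1 \<noteq> v2" "v2 \<noteq> v3" "v1 \<noteq> v3"
      by (auto simp: card_3_iff)
    \<comment> \<open>Otherwise \<open>x\<close> and \<open>S\<close> would be an independent set of
      size 4.\<close>
    have nbr: "adj v1 x \<or> adj v2 x \<or> adj v3 x" if "x \<in> K" for x
      using no_independent_4_set[of v1 v2 v3 x] ne that indep S SK KV VS unfolding S_def[symmetric]
      by auto
    obtain x1 x2 x3 where x: "x1 \<in> K" "\<not> adj v1 x1" "x2 \<in> K" "\<not> adj v2 x2" "x3 \<in> K" "\<not> adj v3 x3"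
      using nonadj[of v1] nonadj[of v2] nonadj[of v3] S by blast
    define b where "b v x = (of_bool (adj v x) :: real)" for v x
    have minor: "(1 - (b v1 x * b v1 x + b v2 x * b v2 x + b v3 x * b v3 x))
        * (1 - (b v1 z * b v1 z + b v2 z * b v2 z + b v3 z * b v3 z))
        = (1 - (b v1 x * b v1 z + b v2 x * b v2 z + b v3 x * b v3 z))\<^sup>2"
      if xz: "x \<in> K" "z \<in> K" for x z
    proof -
      have "adj_eq v x = b v x" "adj_eq v z = b v z" if "v \<in> S" for v
        using that xz SK by (auto simp: adj_eq_def b_def)
      moreover have "\<not> adj v1 v2" "\<not> adj v1 v3" "\<not> adj v2 v3"
        using indep S unfolding S_def[symmetric] by auto
      moreover have "{v1, v2, v3, x, z} \<subseteq> pverts G" "distinct [v1, v2, v3, x]" "z \<notin> {v1, v2, v3}"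
          "adj x z \<or> x = z"
        using VS S SK ne xz K_adj by auto
      ultimately show ?thesis
        using independent_3_set_minor[of v1 v2 v3 x z] S by simp
    qed
    \<comment> \<open>Each of \<open>x1\<close>, \<open>x2\<close>, \<open>x3\<close> has one or two
      neighbours in \<open>S\<close>. By the minors, one with a single neighbour shares it with the
      other two, and any two with two neighbours have the same pair. Either way some vertex of
      \<open>S\<close> is adjacent to all three, although \<open>x1\<close>, \<open>x2\<close>,
      \<open>x3\<close> are missed by \<open>v1\<close>, \<open>v2\<close>,
      \<open>v3\<close>.\<close>
    show False
      using minor[OF x(1) x(3)] minor[OF x(1) x(5)] minor[OF x(3) x(5)] nbr[OF x(1)] nbr[OF x(3)] nbr[OF x(5)] x
      by (cases "adj v1 x2"; cases "adj v1 x3"; cases "adj v2 x1"; cases "adj v2 x3"; cases "adj v3 x1"; cases "adj v3 x2")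
        (simp_all add: b_def)
  qed
  moreover have "card S \<le> 3"
    using indep SV by (intro independent_set_card_le) (auto simp: S_def)
  \<comment> \<open>A clique on \<open>p + 1\<close> vertices has \<open>2 * p\<close> more arcs
    than one on \<open>p\<close> vertices, which exceeds the 4 available.\<close>
  moreover have "card S \<noteq> 0 \<and> card S \<noteq> 1"
  proof (rule ccontr)
    assume "\<not> ?thesis"
    then have "card K \<ge> p + 1"
      using card_KS by auto
    then have "(p + 1) * p \<le> card K * (card K - 1)"
      by (intro mult_le_mono) auto
    also have "\<dots> \<le> p * (p - 1) + 4"
      using card_clique_arcs[OF K(1)] card_arcs by simp
    finally show False
      using p3 by (cases p) (auto simp: algebra_simps)
  qed
  ultimately have card_S: "card S = 2"
    by linarith
  then obtain d e where S: "S = {d, e}" and de: "d \<noteq> e"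
    by (auto simp: card_2_iff)
  have card_K: "card K = p"
    using card_KS card_S by simp
  define D where "D = {v. adj d v}"
  define E where "E = {v. adj e v}"
  have DE: "D \<subseteq> K" "E \<subseteq> K" and fin_DE: "finite D" "finite E"
    using indep finite_nbrs VS S in_arcsD2 unfolding D_def E_def S_def[symmetric] by blast+
  have de_notin: "d \<notin> K" "e \<notin> K"
    using SK S by auto
  let ?C = "{(a, b). a \<in> K \<and> b \<in> K \<and> a \<noteq> b}"
  have finC: "finite ?C"
    by (rule finite_subset[of _ "K \<times> K"]) (use finK in auto)
  \<comment> \<open>As \<open>S\<close> is independent, the arcs are those of \<open>K\<close> and
    two disjoint stars. Each star edge counts twice, so 4 spare arcs mean two edges.\<close>
  have arcs: "parcs G = ?C \<union> ({d} \<times> D \<union> D \<times> {d}) \<union> ({e} \<times> E \<union> E \<times> {e})"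
  proof (intro equalityI subsetI)
    fix z assume z: "z \<in> parcs G"
    then have "fst z \<in> K \<union> S" "snd z \<in> K \<union> S"
      using VS arc_fst_in_verts arc_snd_in_verts by auto
    with z show "z \<in> ?C \<union> ({d} \<times> D \<union> D \<times> {d}) \<union> ({e} \<times> E \<union> E \<times> {e})"
      by (cases z) (auto simp: S D_def E_def dest: adj_sym)
  qed (auto simp: K_adj D_def E_def dest: adj_sym)
  have card_star: "card ({v} \<times> X \<union> X \<times> {v}) = 2 * card X" if "finite X" "v \<notin> X" for v and X :: "'v set"
    using that by (subst card_Un_disjoint) (auto simp: card_cartesian_product)
  have "card (parcs G) = card (?C \<union> ({d} \<times> D \<union> D \<times> {d})) + card ({e} \<times> E \<union> E \<times> {e})"
    unfolding arcs using finC fin_DE DE de de_notin by (intro card_Un_disjoint) auto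
  also have "card (?C \<union> ({d} \<times> D \<union> D \<times> {d})) = card ?C + card ({d} \<times> D \<union> D \<times> {d})"
    using finC fin_DE DE de_notin by (intro card_Un_disjoint) auto
  also have "card ({d} \<times> D \<union> D \<times> {d}) = 2 * card D"
    using card_star[of D d] fin_DE DE de_notin by auto
  also have "card ({e} \<times> E \<union> E \<times> {e}) = 2 * card E"
    using card_star[of E e] fin_DE DE de_notin by auto
  finally have "card (parcs G) = card ?C + 2 * card D + 2 * card E" .
  then have "card D + card E = 2"
    using card_arcs card_off_diagonal[OF finK] card_K by simp
  \<comment> \<open>Two neighbours in \<open>K\<close> would form a triangle with \<open>v\<close>,
    but the triangles inside \<open>K\<close> already exhaust the total.\<close>
  moreover have no_pair: False if v: "v \<in> {d, e}" and card_2: "card {w. adj v w} = 2" for v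
  proof -
    obtain a b where ab: "{w. adj v w} = {a, b}" "a \<noteq> b"
      using card_2 by (auto simp: card_2_iff)
    then have "a \<in> K" "b \<in> K"
      using DE v by (auto simp: D_def E_def)
    then have tri: "insert (v, a, b) (distinct_triples K) \<subseteq> triangles G"
      using ab K_adj by (auto simp: distinct_triples_def triangles_def dest: adj_sym)
    have "finite (triangles G)"
      by (rule finite_subset[of _ "pverts G \<times> pverts G \<times> pverts G"])
        (auto simp: triangles_def pair_finite_verts dest: in_arcsD1 in_arcsD2)
    from card_mono[OF this tri] have "Suc (card (distinct_triples K)) \<le> card (triangles G)"
      using finite_distinct_triples[OF finK] v de_notin by (auto simp: distinct_triples_def)
    with card_triangles card_distinct_triples_cong[of K "{..<p}"] finK card_K show False
      by simp
  qed
  ultimately have "card D + card E = 2" "card D \<noteq> 2" "card E \<noteq> 2"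
    using no_pair[of d] no_pair[of e] unfolding D_def E_def by blast+
  then have "card D = 1 \<and> card E = 1"
    by arith
  then obtain a b where a: "D = {a}" and b: "E = {b}"
    by (auto simp: card_1_singleton_iff)
  \<comment> \<open>Otherwise a third clique vertex, which exists as \<open>p \<ge> 3\<close>,
    completes a bull.\<close>
  have "a = b"
  proof (rule ccontr)
    assume "a \<noteq> b"
    have "\<not> K \<subseteq> {a, b}"
      using card_mono[of "{a, b}" K] card_K p3 \<open>a \<noteq> b\<close> by auto
    then obtain w where w: "w \<in> K" "w \<noteq> a" "w \<noteq> b"
      by blast
    show False
      using no_induced_bull[of d e a b w] w a b DE de de_notin K_adj KV VS S \<open>a \<noteq> b\<close>
      by (auto simp: D_def E_def set_eq_iff)
  qed
  then show thesis
    using that[of K a d e] K(1) card_K de de_notin VS S a b DE by (auto simp: D_def E_def)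
qed

end

section \<open>The isomorphism with the pineapple graph\<close>

lemma digraph_iso_with_projI:
  assumes G: "pair_wf_digraph G" and H: "pair_wf_digraph H"
    and h: "bij_betw h (pverts G) (pverts H)"
    and arcs: "\<And>u v. u \<in> pverts G \<Longrightarrow> v \<in> pverts G \<Longrightarrow> (u, v) \<in> parcs G \<longleftrightarrow> (h u, h v) \<in> parcs H"
  shows "digraph_iso (with_proj G) (with_proj H)"
proof -
  interpret G: pair_wf_digraph G by (rule G)
  interpret H: pair_wf_digraph H by (rule H)
  \<comment> \<open>Arcs are pairs of end vertices, so the vertex map determines the arc
    map.\<close>
  let ?f = "\<lparr> iso_verts = h, iso_arcs = map_prod h h, iso_head = snd, iso_tail = fst \<rparr>"
  have inj: "inj_on h (pverts G)" and img: "h ` pverts G = pverts H"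
    using h by (auto simp: bij_betw_def)
  have sub: "parcs G \<subseteq> pverts G \<times> pverts G"
    using G.in_arcsD1 G.in_arcsD2 by auto
  have "inj_on (map_prod h h) (parcs G)"
    using map_prod_inj_on[OF inj inj] sub by (rule inj_on_subset)
  moreover have "map_prod h h ` parcs G = parcs H"
  proof (intro equalityI subsetI)
    fix x assume "x \<in> map_prod h h ` parcs G"
    then show "x \<in> parcs H"
      using sub arcs by auto
  next
    fix x assume x: "x \<in> parcs H"
    obtain i j where ij: "x = (i, j)"
      by (cases x)
    with x have "i \<in> h ` pverts G" "j \<in> h ` pverts G"
      using H.in_arcsD1 H.in_arcsD2 img by auto
    then obtain u v where "u \<in> pverts G" "v \<in> pverts G" "x = (h u, h v)"
      using ij by blast
    with x arcs show "x \<in> map_prod h h ` parcs G"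
      by (intro image_eqI[of _ _ "(u, v)"]) auto
  qed
  ultimately show ?thesis
    unfolding digraph_iso_def pre_digraph.digraph_isomorphism_def
    using inj img G.wf_digraph_axioms
    by (intro exI[of _ ?f]) (simp add: app_iso_def with_proj_def)
qed

lemma (in pineapple_mate) digraph_iso_pineapple: "digraph_iso (with_proj G) (with_proj (pineapple p 2))"
proof -
  obtain K a d e where K: "clique K" "card K = p" "a \<in> K" and de: "d \<notin> K" "e \<notin> K" "d \<noteq> e"
    and V: "pverts G = K \<union> {d, e}" and nbrs: "{v. adj d v} = {a}" "{v. adj e v} = {a}"
    using pineapple_structure by blast
  have finK: "finite K"
    using V pair_finite_verts by simp
  have "card (K - {a}) = card {1..<p}"
    using K by simp
  then obtain g where g: "bij_betw g (K - {a}) {1..<p}"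
    using finite_same_card_bij[of "K - {a}" "{1..<p}"] finK by blast
  \<comment> \<open>The attaching vertex \<open>a\<close> goes to 0 and the two vertices outside the
    clique to the pendant ones; the rest of the clique may be matched arbitrarily.\<close>
  define h where "h v = (if v = a then 0 else if v = d then p else if v = e then Suc p else g v)" for v
  have gK: "g v \<in> {1..<p}" if "v \<in> K" "v \<noteq> a" for v
    using g that by (auto dest: bij_betw_apply)
  have "bij_betw h (K - {a}) {1..<p}"
    using g de by (subst bij_betw_cong[of _ _ g]) (auto simp: h_def)
  then have "bij_betw h (K - {a} \<union> {a}) ({1..<p} \<union> {0})"
    by (rule bij_betw_combine) (auto simp: h_def)
  moreover have "K - {a} \<union> {a} = K" "{1..<p} \<union> {0} = {..<p}"
    using K(3) p3 by auto
  ultimately have hK: "bij_betw h K {..<p}"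
    by simp
  have hde: "h d = p" "h e = Suc p" "h a = 0"
    using de K(3) by (auto simp: h_def)
  have "bij_betw h (K \<union> {d, e}) ({..<p} \<union> {p, Suc p})"
    using hK by (rule bij_betw_combine) (auto simp: bij_betw_def hde inj_on_def)
  moreover have "{..<p} \<union> {p, Suc p} = pverts (pineapple p 2)"
    by (auto simp: pineapple_def)
  ultimately have bij: "bij_betw h (pverts G) (pverts (pineapple p 2))"
    by (simp add: V)
  have inj: "h u = h v \<longleftrightarrow> u = v" if "u \<in> pverts G" "v \<in> pverts G" for u v
    using bij that by (auto simp: bij_betw_def inj_on_def)
  have hK': "h u < p" if "u \<in> K" for u
    using hK that by (auto dest: bij_betw_apply)
  have adj_d: "adj d v \<longleftrightarrow> v = a" "adj v d \<longleftrightarrow> v = a" "adj e v \<longleftrightarrow> v = a" "adj v e \<longleftrightarrow> v = a" for v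
    using nbrs arc_sym[of v] by auto
  have adj_K: "adj u v \<longleftrightarrow> u \<noteq> v" if "u \<in> K" "v \<in> K" for u v
    using K(1) that by (auto simp: clique_def)
  have pine_K: "(i, j) \<in> parcs (pineapple p 2) \<longleftrightarrow> i \<noteq> j" if "i < p" "j < p" for i j
    using that by (auto simp: pineapple_def)
  have pine_pend: "(p, i) \<in> parcs (pineapple p 2) \<longleftrightarrow> i = 0" "(Suc p, i) \<in> parcs (pineapple p 2) \<longleftrightarrow> i = 0"
    "(i, p) \<in> parcs (pineapple p 2) \<longleftrightarrow> i = 0" "(i, Suc p) \<in> parcs (pineapple p 2) \<longleftrightarrow> i = 0" for i
    using p3 by (auto simp: pineapple_def)
  have h0: "h v = 0 \<longleftrightarrow> v = a" if "v \<in> pverts G" for v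
    using inj[OF that, of a] K(3) V by (simp add: hde)
  have "adj u v \<longleftrightarrow> (h u, h v) \<in> parcs (pineapple p 2)" if uv: "u \<in> pverts G" "v \<in> pverts G" for u v
  proof (cases "u \<in> K \<and> v \<in> K")
    case True
    then show ?thesis
      using adj_K pine_K[OF hK' hK'] inj[OF uv] by simp
  next
    case False
    then have "u \<in> {d, e} \<or> v \<in> {d, e}"
      using uv V by blast
    then show ?thesis
      using h0[OF uv(1)] h0[OF uv(2)] by (elim disjE insertE emptyE) (simp_all add: adj_d hde pine_pend)
  qed
  then show ?thesis
    using digraph_iso_with_projI[OF pair_wf_digraph _ bij] pair_graph_pineapple[of p 2] p3
    by (auto simp: pair_graph_def pair_digraph.pair_wf_digraph)
qed

theorem theorem3p2:
  fixes p :: nat and G :: "'v pair_pre_digraph"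
  assumes "p \<ge> 3"
    and "pair_graph G"
    and "adjacency_spectrum G = adjacency_spectrum (pineapple p 2)"
  shows "digraph_iso (with_proj G) (with_proj (pineapple p 2))"
proof -
  have p: "p \<ge> 1"
    using assms(1) by simp
  show ?thesis
  proof (rule cospectral_pair_graphs[OF assms(2) pair_graph_pineapple[OF p] assms(3)])
    fix y :: "'v \<Rightarrow> nat \<Rightarrow> real"
    assume y: "\<And>u v. u \<in> pverts G \<Longrightarrow> v \<in> pverts G \<Longrightarrow>
        (\<Sum>k\<in>pverts (pineapple p 2). y u k * y v k) = of_bool (u = v)"
      "\<And>u v. u \<in> pverts G \<Longrightarrow> v \<in> pverts G \<Longrightarrow>
        (\<Sum>k\<in>pverts (pineapple p 2). \<Sum>l\<in>pverts (pineapple p 2).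
          y u k * y v l * of_bool ((k, l) \<in> parcs (pineapple p 2))) = of_bool ((u, v) \<in> parcs G)"
      and cards: "card (pverts G) = card (pverts (pineapple p 2))"
        "card (parcs G) = card (parcs (pineapple p 2))"
        "card (triangles G) = card (triangles (pineapple p 2))"
    have "card (pverts (pineapple p 2)) = p + 2"
      by (simp add: pineapple_def)
    \<comment> \<open>The sums over the vertices of the pineapple are rewritten as
      \<open>dot\<close> and \<open>pineapple_form\<close>.\<close>
    then have "pineapple_mate G p y"
      using assms(1,2) y(1)[unfolded dot_eq] y(2)[unfolded pineapple_form_eq[OF p]]
        cards[unfolded card_parcs_pineapple[OF p] triangles_pineapple[OF p]]
      by (intro pineapple_mate.intro pineapple_mate_axioms.intro) auto
    then show ?thesis
      by (rule pineapple_mate.digraph_iso_pineapple)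
  qed
qed

end
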